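(* Suppose that none of the denominators in the following identity vanishes. Then $$\begin{aligned} & \frac{(q,\ aq,\ bq/(y_{1}\cdots y_{n}))_{\infty}}{(aq/(y_{1}\cdots y_{n}),\ bq,\ q/(y_{1}\cdots y_{n}))_{\infty}}\\ &=\sum_{\substack{k_r\ge0\\ r=1,\dots,n}}\ \prod_{1\leq r<s\leq n}\frac{1-q^{k_{r}-k_{s}}x_{r}/x_{s}}{1-x_{r}/x_{s}}\prod_{r,s=1}^{n}\frac{(y_{s}x_{r}/x_{s})_{k_{r}}}{(qx_{r}/x_{s})_{k_{r}}}\\ &\quad\times\frac{(1-aq^{2|\boldsymbol{k}|})(a,q)_{|\boldsymbol{k}|}\,(a/(y_{1}\cdots y_{n}))^{|\boldsymbol{k}|}}{(1-a)(aq/(y_{1}\cdots y_{n}),bq)_{|\boldsymbol{k}|}}\,q^{\sum_{r=1}^{n}(r-1)k_{r}+|\boldsymbol{k}|^{2}}\\ &\quad\times\sum_{\substack{0\leq j_{r}\leq k_{r}\\ r=1,\dots,n}}\ \prod_{1\leq r<s\leq n}\frac{1-q^{j_{r}-j_{s}}x_{r}/x_{s}}{1-x_{r}/x_{s}}\cdot q^{\sum_{r=1}^{n}rj_{r}-|\boldsymbol{k}||\boldsymbol{j}|}\prod_{r,s=1}^{n}\frac{(q^{-k_{s}}x_{r}/x_{s})_{j_{r}}}{(qx_{r}/x_{s})_{j_{r}}}\cdot\frac{(b)_{|\boldsymbol{j}|}(1/a)^{|\boldsymbol{j}|}}{(q^{-|\boldsymbol{k}|})_{|\boldsymbol{j}|}}.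 \end{aligned}$$
   Context: $q$ is a complex number with $0<|q|<1$, $n\ge1$ is an integer, and $a,b,y_1,\dots,y_n,x_1,\dots,x_n$ are complex parameters. $(z)_\infty=\prod_{i\ge0}(1-zq^i)$ and $(z)_k=(z)_\infty/(zq^k)_\infty=\prod_{i=0}^{k-1}(1-zq^i)$; $(c_1,\dots,c_p)_k=(c_1)_k\cdots(c_p)_k$ for $k$ a nonnegative integer or $\infty$. Bold letters denote multi-indices of nonnegative integers, $\boldsymbol k=(k_1,\dots,k_n)$ and $\boldsymbol j=(j_1,\dots,j_n)$, with $|\boldsymbol k|=k_1+\cdots+k_n$ and $|\boldsymbol j|=j_1+\cdots+j_n$.
   Formalization: The identity is stated with a convergence condition that the text omits: either |q/(y_1⋯y_n)|<1 (convergence is then proved) or the n-fold series is assumed to converge absolutely; otherwise it diverges for generic parameters. *)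

theory Defs
  imports "HOL-Analysis.Analysis"
begin

definition qpoch :: "complex \<Rightarrow> complex \<Rightarrow> nat \<Rightarrow> complex" where
  "qpoch q z k = (\<Prod>i<k. 1 - z * q ^ i)"

definition qpoch_inf :: "complex \<Rightarrow> complex \<Rightarrow> complex" where
  "qpoch_inf q z = (\<Prod>i. 1 - z * q ^ i)"

text \<open>Indices \<open>r, s\<close> run over \<open>{1..n}\<close>; a multi-index is an element of
  \<open>{1..n} \<rightarrow>\<^sub>E UNIV\<close>, so that each one is represented by exactly one function.\<close>

definition msize :: "nat \<Rightarrow> (nat \<Rightarrow> nat) \<Rightarrow> nat" where
  "msize n k = (\<Sum>r = 1..n. k r)"

definition vfactor :: "nat \<Rightarrow> complex \<Rightarrow> (nat \<Rightarrow> complex) \<Rightarrow> (nat \<Rightarrow> nat) \<Rightarrow> complex" where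
  "vfactor n q x k =
     (\<Prod>r = 1..n. \<Prod>s\<in>{r<..n}.
        (1 - q powi (int (k r) - int (k s)) * (x r / x s)) / (1 - x r / x s))"

definition inner_sum ::
  "nat \<Rightarrow> complex \<Rightarrow> complex \<Rightarrow> complex \<Rightarrow> (nat \<Rightarrow> complex) \<Rightarrow> (nat \<Rightarrow> nat) \<Rightarrow> complex" where
  "inner_sum n q a b x k =
     (\<Sum>j \<in> (\<Pi>\<^sub>E r\<in>{1..n}. {0..k r}).
        vfactor n q x j
        * q powi ((\<Sum>r = 1..n. int r * int (j r)) - int (msize n k) * int (msize n j))
        * (\<Prod>r = 1..n. \<Prod>s = 1..n.
             qpoch q (q powi (- int (k s)) * (x r / x s)) (j r) / qpoch q (q * (x r / x s)) (j r))
        * (qpoch q b (msize n j) * (1 / a) ^ msize n j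
             / qpoch q (q powi (- int (msize n k))) (msize n j)))"

definition outer_term ::
  "nat \<Rightarrow> complex \<Rightarrow> complex \<Rightarrow> complex \<Rightarrow> (nat \<Rightarrow> complex) \<Rightarrow> (nat \<Rightarrow> complex)
     \<Rightarrow> (nat \<Rightarrow> nat) \<Rightarrow> complex" where
  "outer_term n q a b x y k =
     vfactor n q x k
     * (\<Prod>r = 1..n. \<Prod>s = 1..n.
          qpoch q (y s * (x r / x s)) (k r) / qpoch q (q * (x r / x s)) (k r))
     * ((1 - a * q ^ (2 * msize n k))
          * (qpoch q a (msize n k) * qpoch q q (msize n k)) * (a / (\<Prod>s = 1..n. y s)) ^ msize n k
        / ((1 - a)
          * (qpoch q (a * q / (\<Prod>s = 1..n. y s)) (msize n k) * qpoch q (b * q) (msize n k))))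
     * q ^ ((\<Sum>r = 1..n. (r - 1) * k r) + (msize n k)\<^sup>2)
     * inner_sum n q a b x k"

text \<open>All denominators of the identity are nonzero. The finite factors
  \<open>(aq/(y\<^sub>1\<dots>y\<^sub>n), bq)\<^bsub>|k|\<^esub>\<close> divide the corresponding infinite products, and
  \<open>(q\<^bsup>-|k|\<^esup>)\<^bsub>|j|\<^esub>\<close> never vanishes for \<open>|j| \<le> |k|\<close> when \<open>0 < |q| < 1\<close>,
  so they need no separate clause.\<close>

definition denominators_nonzero ::
  "nat \<Rightarrow> complex \<Rightarrow> complex \<Rightarrow> complex \<Rightarrow> (nat \<Rightarrow> complex) \<Rightarrow> (nat \<Rightarrow> complex) \<Rightarrow> bool" where
  "denominators_nonzero n q a b x y \<longleftrightarrow>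
     a \<noteq> 0 \<and> 1 - a \<noteq> 0 \<and>
     (\<Prod>s = 1..n. y s) \<noteq> 0 \<and>
     (\<forall>s\<in>{1..n}. x s \<noteq> 0) \<and>
     (\<forall>r\<in>{1..n}. \<forall>s\<in>{r<..n}. 1 - x r / x s \<noteq> 0) \<and>
     (\<forall>r\<in>{1..n}. \<forall>s\<in>{1..n}. \<forall>m. qpoch q (q * (x r / x s)) m \<noteq> 0) \<and>
     qpoch_inf q (a * q / (\<Prod>s = 1..n. y s)) \<noteq> 0 \<and>
     qpoch_inf q (b * q) \<noteq> 0 \<and>
     qpoch_inf q (q / (\<Prod>s = 1..n. y s)) \<noteq> 0"

end

(* Milne's fundamental theorem evaluates the sum of the multivariate weights over all multi-indices of a
   fixed size.  Applied to the inner sum (with parameters q^(-k_s)) and then to the outer sum (with parameters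
   y_s), it collapses the identity to one in a single summation index, depending only on a, b and
   u = 1/(y_1...y_n).  Cleared of its denominators, that identity equates a Newton-type series in u with an
   entire function.  At u = q^m the series terminates; the terminating identity is polynomial in b and reduces,
   at b = q^(-i), to the terminating very-well-poised sum, which is summed by telescoping.  The points
   u = q^m accumulate at 0, so the identity theorem gives the result inside the disc of convergence, and
   continuity gives it on the boundary. *)
theory Submission
  imports Defs "HOL-Complex_Analysis.Conformal_Mappings"
begin

section \<open>The fundamental theorem for multiple series\<close>

text \<open>The obstacle is convergence. The summability alternative of the theorem reaches
  parameters with |q/Y| >= 1, where Y = y_1...y_n; there the coefficients are controlled at the
  radius |u| = 1/|Y| and nothing is known beyond it. Hence the comparison with an entire function
  runs on the disc of radius exactly |u|, and u itself is a boundary point. Denominators are cleared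
  for two reasons: the factor (aqu)_inf makes every term entire in u, so the nodes q^m may be used
  even where it vanishes, and the factor (bq)_m turns the terminating identity into one of
  polynomials in b. The nodes are natural: (Y)_K u^K is the product of the u - q^i with i < K, which
  is 0 at u = q^m for K > m; and at b = q^(-i) the inner sum is a finite q-binomial sum while the
  outer terms below i drop out.\<close>

lemma qpoch_0 [simp]: "qpoch q z 0 = 1"
  by (simp add: qpoch_def)

lemma qpoch_Suc: "qpoch q z (Suc k) = qpoch q z k * (1 - z * q ^ k)"
  by (simp add: qpoch_def)

lemma qpoch_add: "qpoch q z (m + k) = qpoch q z m * qpoch q (z * q ^ m) k"
  by (induction k) (simp_all add: qpoch_Suc power_add mult_ac)

lemma qpoch_Suc_left: "qpoch q z (Suc k) = (1 - z) * qpoch q (z * q) k"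
  using qpoch_add[of q z 1 k] by (simp add: qpoch_def)

lemma qpoch_eq_0_iff: "qpoch q z k = 0 \<longleftrightarrow> (\<exists>i<k. z * q ^ i = 1)"
  by (auto simp: qpoch_def)

lemma power_neq_1:
  fixes q :: complex
  assumes "cmod q < 1" "k > 0"
  shows "q ^ k \<noteq> 1"
proof
  assume "q ^ k = 1"
  hence "cmod q ^ k = 1"
    by (metis norm_one norm_power)
  with assms show False
    by (metis less_irrefl norm_ge_zero power_less_one_iff)
qed

lemma qpoch_q_nonzero:
  assumes "cmod q < 1"
  shows "qpoch q q k \<noteq> 0"
  using power_neq_1[OF assms, of "Suc _"] by (auto simp: qpoch_eq_0_iff)

text \<open>The coefficient is taken at \<open>card I\<close>, not at the degree, because the degree
  drops when some \<open>f s\<close> is 0.\<close>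

lemma prod_linear_poly:
  fixes f :: "'a \<Rightarrow> complex"
  assumes "finite I"
  shows "degree (\<Prod>s\<in>I. [:1, f s:]) \<le> card I"
    and "poly.coeff (\<Prod>s\<in>I. [:1, f s:]) (card I) = (\<Prod>s\<in>I. f s)"
proof -
  have "degree (\<Prod>s\<in>I. [:1, f s:]) \<le> card I \<and>
        poly.coeff (\<Prod>s\<in>I. [:1, f s:]) (card I) = (\<Prod>s\<in>I. f s)"
    using assms
  proof (induction I rule: finite_induct)
    case empty
    show ?case by simp
  next
    case (insert t I)
    have "degree ([:1, f t:] * (\<Prod>s\<in>I. [:1, f s:])) \<le> degree [:1, f t:] + degree (\<Prod>s\<in>I. [:1, f s:])"
      by (rule degree_mult_le)
    also have "\<dots> \<le> 1 + card I"
      using insert by (intro add_mono) auto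
    finally have "degree ([:1, f t:] * (\<Prod>s\<in>I. [:1, f s:])) \<le> Suc (card I)"
      by simp
    moreover have "poly.coeff (\<Prod>s\<in>I. [:1, f s:]) (Suc (card I)) = 0"
      using insert by (intro coeff_eq_0) auto
    ultimately show ?case
      using insert by (simp add: mult_pCons_left)
  qed
  thus "degree (\<Prod>s\<in>I. [:1, f s:]) \<le> card I"
    and "poly.coeff (\<Prod>s\<in>I. [:1, f s:]) (card I) = (\<Prod>s\<in>I. f s)" by auto
qed

text \<open>Lagrange interpolation at the nodes \<open>x\<^sub>r\<close> of the polynomial
  \<open>\<Prod>\<^sub>s (1 - c\<^sub>s z/x\<^sub>s) - \<Prod>\<^sub>s c\<^sub>s \<cdot> \<Prod>\<^sub>s (1 - z/x\<^sub>s)\<close>, evaluated at \<open>z = 0\<close>.\<close>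

lemma sum_prod_partial_fraction:
  fixes c x :: "'a \<Rightarrow> complex"
  assumes I: "finite I" and inj: "inj_on x I" and x0: "\<And>s. s \<in> I \<Longrightarrow> x s \<noteq> 0"
  shows "(\<Sum>r\<in>I. (\<Prod>s\<in>I. 1 - c s * (x r / x s)) / (\<Prod>s\<in>I-{r}. 1 - x r / x s)) = 1 - (\<Prod>s\<in>I. c s)"
proof -
  define A where "A = (\<lambda>r. (\<Prod>s\<in>I. 1 - c s * (x r / x s)) / (\<Prod>s\<in>I-{r}. 1 - x r / x s))"
  define p where "p = (\<Prod>s\<in>I. [:1, - c s / x s:])"
  define L where "L = (\<Sum>r\<in>I. Polynomial.smult (A r) (\<Prod>s\<in>I-{r}. [:1, - 1 / x s:]))"
  \<comment> \<open>Lagrange interpolation gives a polynomial of degree below \<open>card I\<close>;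
    the multiple of the nodal polynomial, which vanishes at every node, supplies the top
    coefficient.\<close>
  define Q where "Q = Polynomial.smult (\<Prod>s\<in>I. c s) (\<Prod>s\<in>I. [:1, - 1 / x s:]) + L"
  have L_deg: "degree L \<le> card I" and L_coeff: "poly.coeff L (card I) = 0"
  proof -
    have deg: "degree (\<Prod>s\<in>I-{r}. [:1, - 1 / x s:]) < card I" if "r \<in> I" for r
    proof -
      have "degree (\<Prod>s\<in>I-{r}. [:1, - 1 / x s:]) \<le> card (I - {r})"
        using I by (intro prod_linear_poly) auto
      also have "\<dots> < card I"
        using I that by (rule card_Diff1_less)
      finally show ?thesis .
    qed
    show "degree L \<le> card I"
      unfolding L_def using I deg
      by (intro degree_sum_le) (auto intro!: order.trans[OF degree_smult_le] less_imp_le)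
    show "poly.coeff L (card I) = 0"
      unfolding L_def coeff_sum using deg by (intro sum.neutral) (simp add: coeff_eq_0)
  qed
  have "p = Q"
  proof (rule poly_eqI_degree_lead_coeff)
    show "poly.coeff p (card I) = poly.coeff Q (card I)"
      unfolding p_def Q_def by (simp add: prod_linear_poly[OF I] L_coeff flip: prod.distrib)
    show "card I \<le> card (x ` I)"
      using inj by (simp add: card_image)
    show "degree p \<le> card I"
      unfolding p_def using I by (rule prod_linear_poly)
    show "degree Q \<le> card I"
      unfolding Q_def using L_deg prod_linear_poly(1)[OF I]
      by (intro degree_add_le order.trans[OF degree_smult_le]) auto
    fix z assume "z \<in> x ` I"
    then obtain t where t: "t \<in> I" "z = x t" by auto
    have "poly L z = (\<Sum>r\<in>I. A r * (\<Prod>s\<in>I-{r}. 1 - x t / x s))"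
      by (simp add: L_def t(2) poly_sum poly_prod)
    \<comment> \<open>For r other than t the product contains the factor s = t, which is 0.\<close>
    also have "\<dots> = (\<Sum>r\<in>{t}. A r * (\<Prod>s\<in>I-{r}. 1 - x t / x s))"
      using I t x0 by (intro sum.mono_neutral_right) auto
    also have "\<dots> = poly p z"
    proof -
      have "(\<Prod>s\<in>I-{t}. 1 - x t / x s) \<noteq> 0"
        using I inj t x0 by (auto simp: inj_on_def)
      thus ?thesis
        by (simp add: A_def p_def t(2) poly_prod mult.commute)
    qed
    finally have "poly L z = poly p z" .
    moreover have "poly (\<Prod>s\<in>I. [:1, - 1 / x s:]) z = 0"
      using I t x0 by (auto simp: poly_prod)
    ultimately show "poly p z = poly Q z"
      by (simp add: Q_def)
  qed
  hence "poly p 0 = poly Q 0" by simp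
  thus ?thesis
    by (simp add: p_def Q_def L_def A_def poly_prod poly_sum eq_diff_eq add.commute)
qed

section \<open>Vandermonde products and the weights of Milne's sum\<close>

definition vdm :: "nat \<Rightarrow> (nat \<Rightarrow> complex) \<Rightarrow> complex" where
  "vdm n z = (\<Prod>r = 1..n. \<Prod>s\<in>{r<..n}. z r - z s)"

text \<open>Only the pairs containing \<open>t\<close> change. Those with \<open>s < t\<close> enter
  \<open>vdm\<close> with the opposite sign, which gives (-1)^(t-1) on both sides. The
  cross-multiplied form needs no distinctness of the nodes.\<close>

lemma vdm_update:
  assumes t: "t \<in> {1..n}"
  shows "vdm n (z(t := w)) * (\<Prod>s\<in>{1..n}-{t}. z t - z s) = vdm n z * (\<Prod>s\<in>{1..n}-{t}. w - z s)"
proof -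
  define P where "P = {(r, s). r \<in> {1..n} - {t} \<and> s \<in> {1..n} - {t} \<and> r < s}"
  define D where "D = (\<Prod>(r, s)\<in>P. z r - z s)"
  have eq: "vdm n f = (\<Prod>(r, s)\<in>P. f r - f s) * (\<Prod>s\<in>{t<..n}. f t - f s) * (\<Prod>s\<in>{1..<t}. f s - f t)" for f
  proof -
    have "vdm n f = (\<Prod>(r, s)\<in>(SIGMA r:{1..n}. {r<..n}). f r - f s)"
      unfolding vdm_def by (rule prod.Sigma) auto
    also have "(SIGMA r:{1..n}. {r<..n}) = (P \<union> {t} \<times> {t<..n}) \<union> {1..<t} \<times> {t}"
      using t by (auto simp: P_def)
    also have "(\<Prod>(r, s)\<in>\<dots>. f r - f s) =
        (\<Prod>(r, s)\<in>P. f r - f s) * (\<Prod>(r, s)\<in>{t} \<times> {t<..n}. f r - f s) * (\<Prod>(r, s)\<in>{1..<t} \<times> {t}. f r - f s)"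
    proof -
      have "finite P"
        by (rule finite_subset[of _ "{1..n} \<times> {1..n}"]) (auto simp: P_def)
      thus ?thesis
        by (subst prod.union_disjoint; (subst prod.union_disjoint)?) (auto simp: P_def)
    qed
    also have "(\<Prod>(r, s)\<in>{t} \<times> {t<..n}. f r - f s) = (\<Prod>s\<in>{t<..n}. f t - f s)"
      by (simp flip: prod.cartesian_product)
    also have "(\<Prod>(r, s)\<in>{1..<t} \<times> {t}. f r - f s) = (\<Prod>s\<in>{1..<t}. f s - f t)"
      by (simp flip: prod.cartesian_product)
    finally show ?thesis .
  qed
  have split: "(\<Prod>s\<in>{1..n}-{t}. v - z s) =
      (\<Prod>s\<in>{t<..n}. v - z s) * ((-1) ^ (t - 1) * (\<Prod>s\<in>{1..<t}. z s - v))" for v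
  proof -
    have "{1..n} - {t} = {t<..n} \<union> {1..<t}"
      using t by auto
    moreover have "(\<Prod>s\<in>{t<..n} \<union> {1..<t}. v - z s) = (\<Prod>s\<in>{t<..n}. v - z s) * (\<Prod>s\<in>{1..<t}. v - z s)"
      by (intro prod.union_disjoint) auto
    ultimately have "(\<Prod>s\<in>{1..n}-{t}. v - z s) = (\<Prod>s\<in>{t<..n}. v - z s) * (\<Prod>s\<in>{1..<t}. v - z s)"
      by simp
    also have "(\<Prod>s\<in>{1..<t}. v - z s) = (\<Prod>s\<in>{1..<t}. (-1) * (z s - v))"
      by (intro prod.cong) auto
    also have "\<dots> = (-1) ^ (t - 1) * (\<Prod>s\<in>{1..<t}. z s - v)"
      by (subst prod.distrib) simp
    finally show ?thesis .
  qed
  have "(\<Prod>(r, s)\<in>P. (z(t := w)) r - (z(t := w)) s) = D"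
    unfolding D_def by (intro prod.cong) (auto simp: P_def)
  hence "vdm n (z(t := w)) = D * (\<Prod>s\<in>{t<..n}. w - z s) * (\<Prod>s\<in>{1..<t}. z s - w)"
    by (simp add: eq)
  moreover have "vdm n z = D * (\<Prod>s\<in>{t<..n}. z t - z s) * (\<Prod>s\<in>{1..<t}. z s - z t)"
    by (simp add: eq D_def)
  ultimately show ?thesis
    unfolding split by (simp add: mult_ac)
qed

definition comps :: "nat \<Rightarrow> nat \<Rightarrow> (nat \<Rightarrow> nat) set" where
  "comps n N = {k \<in> {1..n} \<rightarrow>\<^sub>E UNIV. msize n k = N}"

lemma comps_subset: "comps n N \<subseteq> {1..n} \<rightarrow>\<^sub>E {..N}"
proof
  fix k assume k: "k \<in> comps n N"
  have "k r \<le> N" if "r \<in> {1..n}" for r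
    using k member_le_sum[OF that, of k] by (auto simp: comps_def msize_def)
  thus "k \<in> {1..n} \<rightarrow>\<^sub>E {..N}"
    using k by (auto simp: comps_def PiE_def)
qed

lemma finite_comps [simp]: "finite (comps n N)"
  by (rule finite_subset[OF comps_subset]) (auto intro: finite_PiE)

lemma comps_0: "comps n 0 = {\<lambda>r\<in>{1..n}. 0}"
  by (auto simp: comps_def msize_def PiE_def extensional_def restrict_def)

text \<open>The summand of an A_n series. The Vandermonde quotient absorbs \<open>vfactor\<close>
  together with a power of q (see \<open>vfactor_eq\<close>), so that raising one index becomes the
  move of one node.\<close>

definition mweight ::
  "nat \<Rightarrow> complex \<Rightarrow> (nat \<Rightarrow> complex) \<Rightarrow> (nat \<Rightarrow> complex) \<Rightarrow> (nat \<Rightarrow> nat) \<Rightarrow> complex" where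
  "mweight n q x c k = vdm n (\<lambda>r. x r * q ^ k r) / vdm n x *
     (\<Prod>r = 1..n. \<Prod>s = 1..n. qpoch q (c s * (x r / x s)) (k r) / qpoch q (q * (x r / x s)) (k r))"

locale generic_nodes =
  fixes n :: nat and q :: complex and x :: "nat \<Rightarrow> complex"
  assumes q: "0 < cmod q" "cmod q < 1"
    and x_nz: "\<And>s. s \<in> {1..n} \<Longrightarrow> x s \<noteq> 0"
    and x_neq: "\<And>r s. r \<in> {1..n} \<Longrightarrow> s \<in> {1..n} \<Longrightarrow> r \<noteq> s \<Longrightarrow> x r \<noteq> x s"
    and qpoch_nz: "\<And>r s m. r \<in> {1..n} \<Longrightarrow> s \<in> {1..n} \<Longrightarrow> qpoch q (q * (x r / x s)) m \<noteq> 0"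
begin

lemma q_nz [simp]: "q \<noteq> 0"
  using q by auto

text \<open>A coincidence would give, up to exchanging r and s, x_r q^d = x_s with d >= 0. For d = 0
  this contradicts \<open>x_neq\<close>; for d > 0 the last factor of
  \<open>qpoch q (q * (x r / x s)) d\<close> would be 0.\<close>

lemma shifted_neq:
  assumes "r \<in> {1..n}" "s \<in> {1..n}" "r \<noteq> s"
  shows "x r * q ^ i \<noteq> x s * q ^ j"
proof -
  have *: False
    if rs: "r \<in> {1..n}" "s \<in> {1..n}" "r \<noteq> s" and eq: "x r * q ^ i = x s * q ^ j" and "j \<le> i" for r s i j
  proof -
    have "x s * q ^ j = x r * q ^ (i - j) * q ^ j"
      using eq \<open>j \<le> i\<close> by (metis le_add_diff_inverse2 mult.assoc power_add)
    hence e: "x r * q ^ (i - j) = x s"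
      by simp
    show False
    proof (cases "i - j")
      case 0
      thus False using e x_neq[OF rs] by simp
    next
      case (Suc m)
      have "q * (x r / x s) * q ^ m = 1"
        using e Suc x_nz[OF rs(2)] by (simp add: field_simps)
      hence "qpoch q (q * (x r / x s)) (Suc m) = 0"
        by (simp add: qpoch_Suc)
      thus False using qpoch_nz[OF rs(1,2)] by blast
    qed
  qed
  show ?thesis
    using *[of r s i j] *[of s r j i] assms by (cases "j \<le> i") auto
qed

lemma vdm_nz: "vdm n x \<noteq> 0"
  using x_neq by (auto simp: vdm_def)

text \<open>Raising the index \<open>t\<close> moves the node \<open>X t\<close> to
  \<open>w = q * X t\<close>. The Vandermonde product changes by the ratio of the two partial
  fraction denominators, and the factorials change by \<open>A / B\<close>, where \<open>B\<close>
  is the numerator on the left and \<open>A\<close> the one on the right.\<close>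

lemma mweight_step:
  assumes t: "t \<in> {1..n}" and k: "k = m(t := Suc (m t))"
  shows "mweight n q x c k *
      ((\<Prod>s = 1..n. 1 - q ^ k s * ((x t * q ^ k t) / (x s * q ^ k s))) /
       (\<Prod>s\<in>{1..n}-{t}. 1 - (x t * q ^ k t) / (x s * q ^ k s))) =
    mweight n q x c m *
      ((\<Prod>s = 1..n. 1 - (c s * q ^ m s) * ((x t * q ^ m t) / (x s * q ^ m s))) /
       (\<Prod>s\<in>{1..n}-{t}. 1 - (x t * q ^ m t) / (x s * q ^ m s)))"
proof -
  define X where "X = (\<lambda>r. x r * q ^ m r)"
  define w where "w = q * X t"
  define G where "G = (\<lambda>k. \<lambda>r. \<Prod>s = 1..n. qpoch q (c s * (x r / x s)) (k r) / qpoch q (q * (x r / x s)) (k r))"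
  define A where "A = (\<Prod>s = 1..n. 1 - c s * (x t / x s) * q ^ m t)"
  define B where "B = (\<Prod>s = 1..n. 1 - q * (x t / x s) * q ^ m t)"
  define E where "E = (\<Prod>r\<in>{1..n}-{t}. G m r)"
  define C where "C = (\<Prod>s\<in>{1..n}-{t}. X s)"
  have X_nz: "X s \<noteq> 0" if "s \<in> {1..n}" for s
    using x_nz[OF that] by (simp add: X_def)
  have wX: "w - X s \<noteq> 0" "X t - X s \<noteq> 0" if "s \<in> {1..n}-{t}" for s
    using shifted_neq[of t s "Suc (m t)" "m s"] shifted_neq[of t s "m t" "m s"] that t
    by (auto simp: X_def w_def mult_ac)
  have B_nz: "B \<noteq> 0"
    using qpoch_nz[OF t, of _ "Suc (m t)"] by (auto simp: B_def qpoch_Suc)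
  have C_nz: "C \<noteq> 0"
    using X_nz by (auto simp: C_def)
  have Xk: "(\<lambda>r. x r * q ^ k r) = X(t := w)"
    by (auto simp: k X_def w_def fun_eq_iff)
  have Gk: "G k t = G m t * (A / B)"
    by (simp add: G_def A_def B_def k qpoch_Suc prod_dividef prod.distrib)
  have G_eq: "(\<Prod>r = 1..n. G k r) = (\<Prod>r = 1..n. G m r) * (A / B)"
  proof -
    have "(\<Prod>r = 1..n. G k r) = G k t * (\<Prod>r\<in>{1..n}-{t}. G k r)"
      using t by (simp add: prod.remove)
    also have "(\<Prod>r\<in>{1..n}-{t}. G k r) = E"
      unfolding E_def by (intro prod.cong) (auto simp: G_def k)
    also have "G k t * E = G m t * E * (A / B)"
      by (simp add: Gk mult_ac)
    also have "G m t * E = (\<Prod>r = 1..n. G m r)"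
      unfolding E_def using t by (simp add: prod.remove)
    finally show ?thesis .
  qed
  have V: "vdm n (X(t := w)) * (\<Prod>s\<in>{1..n}-{t}. X t - X s) = vdm n X * (\<Prod>s\<in>{1..n}-{t}. w - X s)"
    using t by (rule vdm_update)
  \<comment> \<open>The sign and \<open>C\<close> do not depend on \<open>v\<close>, so they agree
    for the old node and the new one.\<close>
  have den: "(\<Prod>s\<in>{1..n}-{t}. 1 - v / X s) = (-1) ^ (n - 1) * (\<Prod>s\<in>{1..n}-{t}. v - X s) / C" for v
  proof -
    have "(\<Prod>s\<in>{1..n}-{t}. 1 - v / X s) = (\<Prod>s\<in>{1..n}-{t}. (-1) * (v - X s) / X s)"
      using X_nz by (intro prod.cong) (auto simp: field_simps)
    also have "\<dots> = (-1) ^ card ({1..n}-{t}) * (\<Prod>s\<in>{1..n}-{t}. v - X s) / C"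
      unfolding prod_dividef prod.distrib C_def by simp
    finally show ?thesis using t by simp
  qed
  have numB: "(\<Prod>s = 1..n. 1 - q ^ k s * ((x t * q ^ k t) / (x s * q ^ k s))) = B"
    unfolding B_def by (intro prod.cong) (auto simp: k mult_ac)
  have numA: "(\<Prod>s = 1..n. 1 - (c s * q ^ m s) * ((x t * q ^ m t) / (x s * q ^ m s))) = A"
    unfolding A_def by (intro prod.cong) (auto simp: mult_ac)
  have den_k: "(\<Prod>s\<in>{1..n}-{t}. 1 - (x t * q ^ k t) / (x s * q ^ k s)) = (\<Prod>s\<in>{1..n}-{t}. 1 - w / X s)"
    by (intro prod.cong) (auto simp: k w_def X_def)
  have den_m: "(\<Prod>s\<in>{1..n}-{t}. 1 - (x t * q ^ m t) / (x s * q ^ m s)) = (\<Prod>s\<in>{1..n}-{t}. 1 - X t / X s)"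
    by (simp add: X_def)
  define p1 p2 where "p1 = (\<Prod>s\<in>{1..n}-{t}. w - X s)" and "p2 = (\<Prod>s\<in>{1..n}-{t}. X t - X s)"
  have p_nz: "p1 \<noteq> 0" "p2 \<noteq> 0"
    using wX by (auto simp: p1_def p2_def)
  have mk: "mweight n q x c k = vdm n (X(t := w)) / vdm n x * ((\<Prod>r = 1..n. G m r) * (A / B))"
    unfolding mweight_def Xk G_eq[unfolded G_def, symmetric] G_def ..
  have mm: "mweight n q x c m = vdm n X / vdm n x * (\<Prod>r = 1..n. G m r)"
    unfolding mweight_def G_def X_def ..
  have V': "vdm n (X(t := w)) = vdm n X * p1 / p2"
    using V p_nz by (simp add: p1_def p2_def field_simps)
  show ?thesis
    unfolding numA numB den_k den_m den mk mm p1_def[symmetric] p2_def[symmetric] V'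
    using p_nz B_nz C_nz by (simp add: field_simps)
qed

text \<open>Milne's fundamental theorem for \<open>A\<^sub>n\<close> series. The factor \<open>1 - q\<^bsup>N\<^esup>\<close> is expanded by the
  partial fraction identity at the nodes \<open>x\<^sub>r q\<^bsup>k\<^sub>r\<^esup>\<close>; after lowering one index, the same identity
  at the new nodes produces the factor \<open>1 - \<Prod>c\<^sub>s q\<^bsup>N-1\<^esup>\<close>.\<close>

theorem sum_mweight:
  "(\<Sum>k\<in>comps n N. mweight n q x c k) = qpoch q (\<Prod>s = 1..n. c s) N / qpoch q q N"
proof (induction N)
  case 0
  have "(\<Sum>k\<in>comps n 0. mweight n q x c k) = vdm n (\<lambda>r. x r * q ^ (\<lambda>r\<in>{1..n}. 0) r) / vdm n x"
    unfolding comps_0 by (simp add: mweight_def)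
  also have "vdm n (\<lambda>r. x r * q ^ (\<lambda>r\<in>{1..n}. 0) r) = vdm n x"
    unfolding vdm_def by (intro prod.cong) auto
  finally show ?case
    using vdm_nz by simp
next
  case (Suc N)
  define F where "F = (\<lambda>k t. mweight n q x c k *
      ((\<Prod>s = 1..n. 1 - q ^ k s * ((x t * q ^ k t) / (x s * q ^ k s))) /
       (\<Prod>s\<in>{1..n}-{t}. 1 - (x t * q ^ k t) / (x s * q ^ k s))))"
  define G where "G = (\<lambda>m t. mweight n q x c m *
      ((\<Prod>s = 1..n. 1 - (c s * q ^ m s) * ((x t * q ^ m t) / (x s * q ^ m s))) /
       (\<Prod>s\<in>{1..n}-{t}. 1 - (x t * q ^ m t) / (x s * q ^ m s))))"
  have inj: "inj_on (\<lambda>r. x r * q ^ k r) {1..n}" for k :: "nat \<Rightarrow> nat"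
    unfolding inj_on_def using shifted_neq by metis
  have nz: "x r * q ^ k r \<noteq> 0" if "r \<in> {1..n}" for r and k :: "nat \<Rightarrow> nat"
    using x_nz[OF that] by simp
  have F_sum: "(\<Sum>t = 1..n. F k t) = (1 - q ^ Suc N) * mweight n q x c k" if "k \<in> comps n (Suc N)" for k
  proof -
    have "(\<Prod>s = 1..n. q ^ k s) = q ^ Suc N"
      using that by (simp add: comps_def msize_def flip: power_sum)
    thus ?thesis
      unfolding F_def sum_distrib_left[symmetric]
      using sum_prod_partial_fraction[OF finite_atLeastAtMost inj[of k] nz[where k = k], where c = "\<lambda>s. q ^ k s"] by simp
  qed
  have G_sum: "(\<Sum>t = 1..n. G m t) = (1 - (\<Prod>s = 1..n. c s) * q ^ N) * mweight n q x c m"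
    if "m \<in> comps n N" for m
  proof -
    have "(\<Prod>s = 1..n. c s * q ^ m s) = (\<Prod>s = 1..n. c s) * q ^ N"
      using that by (simp add: comps_def msize_def prod.distrib flip: power_sum)
    thus ?thesis
      unfolding G_def sum_distrib_left[symmetric]
      using sum_prod_partial_fraction[OF finite_atLeastAtMost inj[of m] nz[where k = m], where c = "\<lambda>s. c s * q ^ m s"] by simp
  qed
  \<comment> \<open>The factor s = t is \<open>1 - q ^ k t\<close>, so the terms whose index
    \<open>t\<close> cannot be lowered vanish.\<close>
  have F0: "F k t = 0" if "t \<in> {1..n}" "k t = 0" for k t
  proof -
    have "(\<Prod>s = 1..n. 1 - q ^ k s * ((x t * q ^ k t) / (x s * q ^ k s))) = 0"
      using that x_nz[OF that(1)] by (intro prod_zero) (auto intro!: bexI[of _ t])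
    thus ?thesis by (simp add: F_def)
  qed
  have msize_upd: "msize n (m(t := Suc (m t))) = Suc (msize n m)" if "t \<in> {1..n}" for m t
  proof -
    have "msize n (m(t := Suc (m t))) = Suc (m t) + (\<Sum>r\<in>{1..n}-{t}. (m(t := Suc (m t))) r)"
      unfolding msize_def using that by (subst sum.remove[of _ t]) auto
    also have "(\<Sum>r\<in>{1..n}-{t}. (m(t := Suc (m t))) r) = (\<Sum>r\<in>{1..n}-{t}. m r)"
      by (intro sum.cong) auto
    also have "Suc (m t) + (\<Sum>r\<in>{1..n}-{t}. m r) = Suc (msize n m)"
      unfolding msize_def using that by (subst sum.remove[of _ t]) auto
    finally show ?thesis .
  qed
  \<comment> \<open>These pairs are exactly the ones obtained by raising the index \<open>t\<close>
    of a multi-index of size \<open>N\<close>.\<close>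
  define S1 where "S1 = {(k, t). k \<in> comps n (Suc N) \<and> t \<in> {1..n} \<and> 0 < k t}"
  have "(1 - q ^ Suc N) * (\<Sum>k\<in>comps n (Suc N). mweight n q x c k) =
      (\<Sum>k\<in>comps n (Suc N). \<Sum>t = 1..n. F k t)"
    unfolding sum_distrib_left by (intro sum.cong refl) (simp only: F_sum)
  also have "\<dots> = (\<Sum>(k, t)\<in>comps n (Suc N) \<times> {1..n}. F k t)"
    by (rule sum.cartesian_product)
  also have "\<dots> = (\<Sum>(k, t)\<in>S1. F k t)"
  proof (rule sum.mono_neutral_right)
    show "\<forall>p\<in>comps n (Suc N) \<times> {1..n} - S1. (case p of (k, t) \<Rightarrow> F k t) = 0"
    proof
      fix p assume "p \<in> comps n (Suc N) \<times> {1..n} - S1"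
      moreover obtain k t where "p = (k, t)"
        by (cases p)
      ultimately have "p = (k, t)" "t \<in> {1..n}" "\<not> 0 < k t"
        by (auto simp: S1_def)
      thus "(case p of (k, t) \<Rightarrow> F k t) = 0"
        using F0[of t k] by simp
    qed
  qed (auto simp: S1_def)
  also have "\<dots> = (\<Sum>(m, t)\<in>comps n N \<times> {1..n}. G m t)"
  proof (rule sum.reindex_bij_witness
      [of _ "\<lambda>(m, t). (m(t := Suc (m t)), t)" "\<lambda>(k, t). (k(t := k t - 1), t)"])
    fix p assume p: "p \<in> S1"
    then obtain k t where kt: "p = (k, t)" "k \<in> comps n (Suc N)" "t \<in> {1..n}" "k t \<noteq> 0"
      by (auto simp: S1_def)
    define m where "m = k(t := k t - 1)"
    have k: "k = m(t := Suc (m t))"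
      using kt by (auto simp: m_def)
    have "Suc (msize n m) = Suc N"
      using kt(2) msize_upd[OF kt(3), of m] by (simp add: comps_def flip: k)
    hence m: "m \<in> comps n N"
      using kt by (auto simp: comps_def m_def PiE_def extensional_def)
    show "(case case p of (k, t) \<Rightarrow> (k(t := k t - 1), t) of (m, t) \<Rightarrow> (m(t := Suc (m t)), t)) = p"
      using kt by auto
    show "(case p of (k, t) \<Rightarrow> (k(t := k t - 1), t)) \<in> comps n N \<times> {1..n}"
      using kt m by (simp add: m_def)
    have "F k t = G m t"
      unfolding F_def G_def using mweight_step[OF kt(3) k] .
    thus "(case case p of (k, t) \<Rightarrow> (k(t := k t - 1), t) of (m, t) \<Rightarrow> G m t) = (case p of (k, t) \<Rightarrow> F k t)"
      using kt by (simp add: m_def)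
  next
    fix p assume p: "p \<in> comps n N \<times> {1..n}"
    thus "(case case p of (m, t) \<Rightarrow> (m(t := Suc (m t)), t) of (k, t) \<Rightarrow> (k(t := k t - 1), t)) = p"
      by auto
    show "(case p of (m, t) \<Rightarrow> (m(t := Suc (m t)), t)) \<in> S1"
      using p msize_upd by (auto simp: S1_def comps_def PiE_def extensional_def)
  qed
  also have "\<dots> = (\<Sum>m\<in>comps n N. \<Sum>t = 1..n. G m t)"
    by (rule sum.cartesian_product[symmetric])
  also have "\<dots> = (1 - (\<Prod>s = 1..n. c s) * q ^ N) * (\<Sum>m\<in>comps n N. mweight n q x c m)"
    unfolding sum_distrib_left by (intro sum.cong refl) (simp only: G_sum)
  finally have "(1 - q ^ Suc N) * (\<Sum>k\<in>comps n (Suc N). mweight n q x c k) =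
      (1 - (\<Prod>s = 1..n. c s) * q ^ N) * (qpoch q (\<Prod>s = 1..n. c s) N / qpoch q q N)"
    using Suc.IH by simp
  moreover have "1 - q ^ Suc N \<noteq> 0"
    using power_neq_1[OF q(2), of "Suc N"] by simp
  ultimately have "(\<Sum>k\<in>comps n (Suc N). mweight n q x c k) =
      (1 - (\<Prod>s = 1..n. c s) * q ^ N) * (qpoch q (\<Prod>s = 1..n. c s) N / qpoch q q N) / (1 - q ^ Suc N)"
    by (metis nonzero_mult_div_cancel_left)
  thus ?case
    by (simp add: qpoch_Suc mult_ac)
qed

end

section \<open>The terminating one-variable identity\<close>

text \<open>Divided by \<open>qpoch q a (2 * M + 1)\<close> this is, up to a factor free of
  \<open>L\<close>, the summand of the terminating very-well-poised 6phi5 series with two parameters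
  sent to infinity. The form without \<open>a\<close> in a denominator makes the summation valid for
  every \<open>a\<close>.\<close>

definition vwp_term :: "complex \<Rightarrow> complex \<Rightarrow> nat \<Rightarrow> nat \<Rightarrow> complex" where
  "vwp_term q a M L =
     qpoch q q M / (qpoch q q L * qpoch q q (M - L)) * (1 - a * q ^ (2 * L)) * qpoch q a L
     * (- a) ^ L * q ^ ((L choose 2) + L\<^sup>2) * qpoch q (a * q ^ (L + M + 1)) (M - L)"

lemma Suc_choose_2: "Suc L choose 2 = (L choose 2) + L"
  by (simp add: numeral_2_eq_2)

text \<open>The right-hand side is the certificate of a Wilf--Zeilberger pair for
  \<open>vwp_term q a M L / qpoch q a (2 * M + 1)\<close>, with denominators cleared.\<close>

lemma vwp_partial_sum:
  assumes q: "cmod q < 1" and "N \<le> M"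
  shows "(\<Sum>L\<le>N. vwp_term q a (Suc M) L)
           - (1 - a * q ^ (2 * M + 1)) * (1 - a * q ^ (2 * M + 2)) * (\<Sum>L\<le>N. vwp_term q a M L)
         = - (qpoch q q M / (qpoch q q N * qpoch q q (M - N)) * (- a) ^ Suc N
              * q ^ ((Suc N choose 2) + (Suc N)\<^sup>2 + (M - N)) * qpoch q a (Suc N)
              * qpoch q (a * q ^ (N + M + 2)) (Suc (M - N)))"
  using \<open>N \<le> M\<close>
proof (induction N)
  case 0
  define P where "P = qpoch q (a * q ^ (M + 2)) (Suc M)"
  \<comment> \<open>Two ways to split \<open>qpoch q (a * q ^ (M + 1)) (M + 2)\<close>: the first
    factor off, or the last two.\<close>
  have 1: "(1 - a * q ^ (2 * M + 1)) * (1 - a * q ^ (2 * M + 2)) * qpoch q (a * q ^ (M + 1)) M = (1 - a * q ^ (M + 1)) * P"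
  proof -
    have "qpoch q (a * q ^ (M + 1)) (Suc (Suc M)) = (1 - a * q ^ (M + 1)) * P"
      unfolding P_def by (subst qpoch_Suc_left) (simp add: mult_ac)
    moreover have "qpoch q (a * q ^ (M + 1)) (Suc (Suc M)) =
        qpoch q (a * q ^ (M + 1)) M * (1 - a * q ^ (2 * M + 1)) * (1 - a * q ^ (2 * M + 2))"
      unfolding mult_2 by (simp add: qpoch_Suc power_add mult_ac)
    ultimately show ?thesis by (simp add: mult_ac)
  qed
  have P': "qpoch q (a * q ^ (Suc M + 1)) (Suc M) = P"
    by (simp add: P_def)
  have e1: "(\<Sum>L\<le>0. vwp_term q a (Suc M) L) = (1 - a) * P"
    using qpoch_q_nonzero[OF q] by (simp add: vwp_term_def P'[simplified] binomial_eq_0)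
  have e2: "(1 - a * q ^ (2 * M + 1)) * (1 - a * q ^ (2 * M + 2)) * (\<Sum>L\<le>0. vwp_term q a M L)
      = (1 - a) * ((1 - a * q ^ (M + 1)) * P)"
    unfolding 1[symmetric] using qpoch_q_nonzero[OF q] by (simp add: vwp_term_def binomial_eq_0)
  have e3: "qpoch q a (Suc 0) = 1 - a"
    by (simp add: qpoch_Suc)
  show ?case
    unfolding e1 e2 e3 using qpoch_q_nonzero[OF q] by (simp add: P_def Suc_choose_2 binomial_eq_0 algebra_simps)
next
  case (Suc N)
  define L where "L = Suc N"
  obtain d where d: "M = L + d"
    using Suc.prems by (auto simp: L_def le_iff_add)
  define P where "P = qpoch q (a * q ^ (L + M + 2)) (Suc d)"
  define R where "R = qpoch q q M / (qpoch q q L * qpoch q q (Suc d))"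
  \<comment> \<open>\<open>T\<close> is the common factor of the four quantities \<open>A\<close> to
    \<open>D\<close>. Dividing by it leaves \<open>key\<close>, a polynomial identity in a, q, q^L
    and q^d.\<close>
  define T where "T = R * qpoch q a L * (- a) ^ L * q ^ ((L choose 2) + L\<^sup>2) * P"
  note nz = qpoch_q_nonzero[OF q]
  have nz': "1 - q ^ L \<noteq> 0" "1 - q ^ Suc d \<noteq> 0"
    using power_neq_1[OF q, of L] power_neq_1[OF q, of "Suc d"] by (auto simp: L_def)
  have 1: "(1 - a * q ^ (2 * M + 1)) * (1 - a * q ^ (2 * M + 2)) * qpoch q (a * q ^ (L + M + 1)) d
      = (1 - a * q ^ (L + M + 1)) * P"
  proof -
    have "qpoch q (a * q ^ (L + M + 1)) (Suc (Suc d)) = (1 - a * q ^ (L + M + 1)) * P"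
      unfolding P_def by (subst qpoch_Suc_left) (simp add: mult_ac)
    moreover have "qpoch q (a * q ^ (L + M + 1)) (Suc (Suc d)) =
        qpoch q (a * q ^ (L + M + 1)) d * (1 - a * q ^ (2 * M + 1)) * (1 - a * q ^ (2 * M + 2))"
      unfolding mult_2 by (simp add: qpoch_Suc power_add mult_ac d)
    ultimately show ?thesis by (simp add: mult_ac)
  qed
  have A: "vwp_term q a (Suc M) L = (1 - q ^ Suc M) * (1 - a * q ^ (2 * L)) * T"
  proof -
    have "Suc M - L = Suc d"
      by (simp add: d)
    thus ?thesis
      unfolding vwp_term_def T_def R_def P_def by (simp add: qpoch_Suc[of q q M] mult_ac)
  qed
  have B: "(1 - a * q ^ (2 * M + 1)) * (1 - a * q ^ (2 * M + 2)) * vwp_term q a M L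
      = (1 - q ^ Suc d) * (1 - a * q ^ (2 * L)) * (1 - a * q ^ (L + M + 1)) * T"
  proof -
    have "M - L = d"
      by (simp add: d)
    hence "(1 - a * q ^ (2 * M + 1)) * (1 - a * q ^ (2 * M + 2)) * vwp_term q a M L =
        qpoch q q M / (qpoch q q L * qpoch q q d) * (1 - a * q ^ (2 * L)) * qpoch q a L
        * (- a) ^ L * q ^ ((L choose 2) + L\<^sup>2) * ((1 - a * q ^ (L + M + 1)) * P)"
      unfolding vwp_term_def 1[symmetric] by (simp add: mult_ac)
    also have "qpoch q q M / (qpoch q q L * qpoch q q d) = (1 - q ^ Suc d) * R"
      using nz nz' by (simp add: R_def qpoch_Suc[of q q d] field_simps)
    finally show ?thesis
      by (simp add: T_def mult_ac)
  qed
  have C: "- (qpoch q q M / (qpoch q q N * qpoch q q (M - N)) * (- a) ^ Suc N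
              * q ^ ((Suc N choose 2) + (Suc N)\<^sup>2 + (M - N)) * qpoch q a (Suc N)
              * qpoch q (a * q ^ (N + M + 2)) (Suc (M - N)))
      = - ((1 - q ^ L) * q ^ Suc d * (1 - a * q ^ (L + M + 1)) * T)"
  proof -
    have MN: "M - N = Suc d" and NL: "N + M + 2 = L + M + 1"
      by (simp_all add: d L_def)
    have "qpoch q q M / (qpoch q q N * qpoch q q (Suc d)) = (1 - q ^ L) * R"
      using nz nz' by (simp add: R_def L_def qpoch_Suc[of q q N] field_simps)
    moreover have "qpoch q (a * q ^ (L + M + 1)) (Suc (Suc d)) = (1 - a * q ^ (L + M + 1)) * P"
      unfolding P_def by (subst qpoch_Suc_left) (simp add: mult_ac)
    ultimately show ?thesis
      unfolding MN NL by (simp add: T_def power_add mult_ac flip: L_def)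
  qed
  have D: "- (qpoch q q M / (qpoch q q L * qpoch q q (M - L)) * (- a) ^ Suc L
              * q ^ ((Suc L choose 2) + (Suc L)\<^sup>2 + (M - L)) * qpoch q a (Suc L)
              * qpoch q (a * q ^ (L + M + 2)) (Suc (M - L)))
      = (1 - q ^ Suc d) * a * q ^ (3 * L + 1 + d) * (1 - a * q ^ L) * T"
  proof -
    have Md: "M - L = d"
      by (simp add: d)
    have e: "(Suc L choose 2) + (Suc L)\<^sup>2 + d = (L choose 2) + L\<^sup>2 + (3 * L + 1 + d)"
      by (simp add: Suc_choose_2 power2_eq_square)
    have "qpoch q q M / (qpoch q q L * qpoch q q d) = (1 - q ^ Suc d) * R"
      using nz nz' by (simp add: R_def qpoch_Suc[of q q d] field_simps)
    thus ?thesis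
      unfolding Md e power_add[of q _ "3 * L + 1 + d"] qpoch_Suc[of q a L] P_def[symmetric]
      by (simp add: T_def mult_ac)
  qed
  have key: "(1 - q ^ Suc M) * (1 - a * q ^ (2 * L))
      - (1 - q ^ Suc d) * (1 - a * q ^ (2 * L)) * (1 - a * q ^ (L + M + 1))
      = (1 - q ^ Suc d) * a * q ^ (3 * L + 1 + d) * (1 - a * q ^ L)
        + (1 - q ^ L) * q ^ Suc d * (1 - a * q ^ (L + M + 1))"
  proof -
    define x y where "x = q ^ L" and "y = q ^ d"
    have pw: "q ^ Suc M = q * x * y" "q ^ (2 * L) = x * x" "q ^ Suc d = q * y"
       "q ^ (L + M + 1) = q * x * x * y" "q ^ (3 * L + 1 + d) = q * x * x * x * y" "q ^ L = x"
      unfolding mult_2 by (simp_all add: x_def y_def d power_add numeral_3_eq_3 mult_ac)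
    show ?thesis
      unfolding pw by (simp add: algebra_simps)
  qed
  have "(\<Sum>L\<le>Suc N. vwp_term q a (Suc M) L)
           - (1 - a * q ^ (2 * M + 1)) * (1 - a * q ^ (2 * M + 2)) * (\<Sum>L\<le>Suc N. vwp_term q a M L)
      = ((\<Sum>L\<le>N. vwp_term q a (Suc M) L)
           - (1 - a * q ^ (2 * M + 1)) * (1 - a * q ^ (2 * M + 2)) * (\<Sum>L\<le>N. vwp_term q a M L))
        + (vwp_term q a (Suc M) L - (1 - a * q ^ (2 * M + 1)) * (1 - a * q ^ (2 * M + 2)) * vwp_term q a M L)"
    by (simp add: L_def algebra_simps)
  also have "(\<Sum>L\<le>N. vwp_term q a (Suc M) L)
           - (1 - a * q ^ (2 * M + 1)) * (1 - a * q ^ (2 * M + 2)) * (\<Sum>L\<le>N. vwp_term q a M L)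
      = - ((1 - q ^ L) * q ^ Suc d * (1 - a * q ^ (L + M + 1)) * T)"
    using Suc.IH Suc.prems C by simp
  also have "\<dots> + (vwp_term q a (Suc M) L - (1 - a * q ^ (2 * M + 1)) * (1 - a * q ^ (2 * M + 2)) * vwp_term q a M L)
      = (((1 - q ^ Suc M) * (1 - a * q ^ (2 * L))
      - (1 - q ^ Suc d) * (1 - a * q ^ (2 * L)) * (1 - a * q ^ (L + M + 1)))
       - (1 - q ^ L) * q ^ Suc d * (1 - a * q ^ (L + M + 1))) * T"
    unfolding A B by (simp only: ring_distribs minus_mult_left) simp
  also have "\<dots> = (1 - q ^ Suc d) * a * q ^ (3 * L + 1 + d) * (1 - a * q ^ L) * T"
    unfolding key by simp
  also note D[symmetric]
  finally show ?case
    by (simp only: L_def)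
qed

text \<open>At \<open>N = M\<close> the right-hand side of \<open>vwp_partial_sum\<close> is minus
  the term \<open>L = Suc M\<close> that its first sum lacks, so the full sums satisfy the
  recurrence of \<open>qpoch q a (2 * M + 1)\<close>.\<close>

lemma sum_vwp_term:
  assumes q: "cmod q < 1"
  shows "(\<Sum>L\<le>M. vwp_term q a M L) = qpoch q a (2 * M + 1)"
proof (induction M)
  case 0
  show ?case by (simp add: vwp_term_def qpoch_Suc binomial_eq_0)
next
  case (Suc M)
  note nz = qpoch_q_nonzero[OF q]
  have last: "vwp_term q a (Suc M) (Suc M) =
      (- a) ^ Suc M * q ^ ((Suc M choose 2) + (Suc M)\<^sup>2) * qpoch q a (Suc M) * (1 - a * q ^ (2 * M + 2))"
    using nz by (simp add: vwp_term_def)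
  have "- (qpoch q q M / (qpoch q q M * qpoch q q (M - M)) * (- a) ^ Suc M
              * q ^ ((Suc M choose 2) + (Suc M)\<^sup>2 + (M - M)) * qpoch q a (Suc M)
              * qpoch q (a * q ^ (M + M + 2)) (Suc (M - M))) = - vwp_term q a (Suc M) (Suc M)"
    unfolding last using nz[of M] by (simp add: qpoch_Suc[of _ _ 0] mult_2)
  with vwp_partial_sum[OF q order.refl, of a M]
  have "(\<Sum>L\<le>Suc M. vwp_term q a (Suc M) L) =
      (1 - a * q ^ (2 * M + 1)) * (1 - a * q ^ (2 * M + 2)) * qpoch q a (2 * M + 1)"
    unfolding Suc.IH by (simp add: algebra_simps)
  also have "\<dots> = qpoch q a (Suc (Suc (2 * M + 1)))"
    by (simp add: qpoch_Suc)
  finally show ?case by simp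
qed

text \<open>Here b = q^(-i), and the induction replaces b by bq. The identity \<open>step\<close>
  makes the sum for b a combination of two sums for bq with different upper limits, which is why
  \<open>N\<close> is arbitrary above i.\<close>

lemma terminating_q_binomial:
  assumes q: "cmod q < 1" and "b * q ^ i = 1" "i \<le> N"
  shows "(\<Sum>J\<le>N. qpoch q b J / qpoch q q J * z ^ J) = qpoch q (z * b) i"
  using assms(2,3)
proof (induction i arbitrary: b N)
  case 0
  have "qpoch q b J = 0" if "J > 0" for J
    using 0 that by (auto simp: qpoch_eq_0_iff)
  hence "(\<Sum>J\<le>N. qpoch q b J / qpoch q q J * z ^ J) = (\<Sum>J\<in>{0}. qpoch q b J / qpoch q q J * z ^ J)"
    by (intro sum.mono_neutral_right) auto
  thus ?case by simp
next
  case (Suc i)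
  then obtain N' where N: "N = Suc N'" "i \<le> N'"
    by (cases N) auto
  note nz = qpoch_q_nonzero[OF q]
  define A where "A = (\<lambda>J. qpoch q (b * q) J / qpoch q q J * z ^ J)"
  have bq: "b * q * q ^ i = 1"
    using Suc.prems by (simp add: mult_ac)
  have step: "qpoch q b (Suc J) / qpoch q q (Suc J) * z ^ Suc J = A (Suc J) - z * b * A J" for J
  proof -
    have *: "1 - q ^ Suc J \<noteq> 0"
      using power_neq_1[OF q, of "Suc J"] by simp
    have "qpoch q b (Suc J) = (1 - b) * qpoch q (b * q) J"
      by (rule qpoch_Suc_left)
    moreover have "qpoch q (b * q) (Suc J) = qpoch q (b * q) J * (1 - b * q ^ Suc J)"
      by (simp add: qpoch_Suc mult_ac)
    moreover have "qpoch q q (Suc J) = qpoch q q J * (1 - q ^ Suc J)"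
      by (simp add: qpoch_Suc)
    ultimately show ?thesis
      unfolding A_def using nz[of J] * by (simp add: divide_simps del: power_Suc) (simp add: algebra_simps)
  qed
  have "(\<Sum>J\<le>N. qpoch q b J / qpoch q q J * z ^ J) = 1 + (\<Sum>J\<le>N'. A (Suc J) - z * b * A J)"
    unfolding N sum.atMost_Suc_shift step by simp
  also have "\<dots> = (\<Sum>J\<le>N. A J) - z * b * (\<Sum>J\<le>N'. A J)"
    unfolding N sum.atMost_Suc_shift sum_subtractf by (simp add: A_def sum_distrib_left)
  also have "\<dots> = (1 - z * b) * qpoch q (z * (b * q)) i"
    using Suc.IH[OF bq, of N] Suc.IH[OF bq, of N'] N by (simp add: A_def algebra_simps)
  also have "\<dots> = qpoch q (z * b) (Suc i)"
    by (simp add: qpoch_Suc_left mult_ac)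
  finally show ?case .
qed

text \<open>The factors on the left are 1 - 1/(a q^(K+j)) for j < i, and multiplication by -a
  q^(K+j) turns each into -(1/1 - a q^(K+j)) up to sign, a factor of the right side.\<close>

lemma qpoch_reverse:
  assumes "q \<noteq> 0" "a \<noteq> 0"
  shows "qpoch q (q / (a * q ^ (K + i))) i * ((- a) ^ i * q ^ (i * K + (i choose 2))) = qpoch q (a * q ^ K) i"
proof (induction i)
  case 0
  show ?case by (simp add: numeral_2_eq_2)
next
  case (Suc i)
  have "qpoch q (q / (a * q ^ (K + Suc i))) (Suc i) =
      (1 - 1 / (a * q ^ (K + i))) * qpoch q (q / (a * q ^ (K + i))) i"
    using assms by (subst qpoch_Suc_left) (simp add: field_simps)
  moreover have "(- a) ^ Suc i * q ^ (Suc i * K + (Suc i choose 2)) =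
      ((- a) ^ i * q ^ (i * K + (i choose 2))) * ((- a) * q ^ (K + i))"
    by (simp add: Suc_choose_2 power_add mult_ac)
  ultimately have "qpoch q (q / (a * q ^ (K + Suc i))) (Suc i) * ((- a) ^ Suc i * q ^ (Suc i * K + (Suc i choose 2)))
     = qpoch q (a * q ^ K) i * ((1 - 1 / (a * q ^ (K + i))) * ((- a) * q ^ (K + i)))"
    unfolding Suc.IH[symmetric] by (simp only: mult_ac)
  also have "(1 - 1 / (a * q ^ (K + i))) * ((- a) * q ^ (K + i)) = 1 - a * q ^ K * q ^ i"
    using assms by (simp add: field_simps power_add)
  finally show ?case
    by (simp add: qpoch_Suc)
qed

section \<open>The terminating identity as an identity in b\<close>

definition bsum :: "complex \<Rightarrow> complex \<Rightarrow> complex \<Rightarrow> nat \<Rightarrow> complex" where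
  "bsum q a b K = (\<Sum>J\<le>K. qpoch q b J / qpoch q q J * (q / (a * q ^ K)) ^ J)"

text \<open>The part free of b of the K-th term at u = q^m, up to a factor free of K. The sign,
  \<open>q ^ (K choose 2)\<close> and \<open>qpoch q q (m - K)\<close> come from the Newton product
  (\<open>nprod_at_power\<close>), the last factorial in the numerator from clearing
  (aqu)_inf.\<close>

definition bailey_term :: "complex \<Rightarrow> complex \<Rightarrow> nat \<Rightarrow> nat \<Rightarrow> complex" where
  "bailey_term q a m K = (1 - a * q ^ (2 * K)) * qpoch q a K * (- a) ^ K * q ^ ((K choose 2) + K\<^sup>2)
     * qpoch q (a * q ^ (K + m + 1)) (m - K) / qpoch q q (m - K)"

lemma choose_2_add: "(i + L) choose 2 = (i choose 2) + (L choose 2) + i * L" for i L :: nat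
  by (induction L) (simp_all add: Suc_choose_2 numeral_2_eq_2[symmetric])

text \<open>For K < i the factor 1 - b q^i of \<open>qpoch q (b * q ^ (K + 1)) (m - K)\<close> is 0.
  The terms K = L + i form the very-well-poised sum with a q^(2i) for a and m - i for M.\<close>

lemma sum_bailey_at_power:
  assumes q: "q \<noteq> 0" "cmod q < 1" and a: "a \<noteq> 0" and b: "b * q ^ i = 1" and "i \<le> m"
  shows "(\<Sum>K\<le>m. bailey_term q a m K * (bsum q a b K * qpoch q (b * q ^ (K + 1)) (m - K))) = qpoch q a (2 * m + 1)"
proof -
  define M where "M = m - i"
  have m: "m = M + i"
    using \<open>i \<le> m\<close> by (simp add: M_def)
  note nz = qpoch_q_nonzero[OF q(2)]
  define f where "f = (\<lambda>K. bailey_term q a m K * (bsum q a b K * qpoch q (b * q ^ (K + 1)) (m - K)))"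
  have low: "f K = 0" if "K < i" for K
  proof -
    have "b * q ^ (K + 1) * q ^ (i - K - 1) = b * q ^ ((K + 1) + (i - K - 1))"
      by (simp only: power_add mult.assoc)
    also have "(K + 1) + (i - K - 1) = i"
      using that by simp
    finally have "b * q ^ (K + 1) * q ^ (i - K - 1) = 1"
      using b by simp
    moreover have "i - K - 1 < m - K"
      using that \<open>i \<le> m\<close> by linarith
    ultimately have "qpoch q (b * q ^ (K + 1)) (m - K) = 0"
      unfolding qpoch_eq_0_iff by blast
    thus ?thesis by (simp add: f_def)
  qed
  have high: "f (L + i) = qpoch q a (2 * i) * vwp_term q (a * q ^ (2 * i)) M L" if "L \<le> M" for L
  proof -
    define K where "K = L + i"
    have mK: "m - K = M - L"
      by (simp add: m K_def)
    have b': "b = 1 / q ^ i"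
      using b q by (simp add: field_simps)
    have S: "bsum q a b K * ((- a) ^ i * q ^ (i * K + (i choose 2))) = qpoch q (a * q ^ K) i"
    proof -
      have "bsum q a b K = qpoch q (q / (a * q ^ K) * b) i"
        unfolding bsum_def using q b by (intro terminating_q_binomial) (auto simp: K_def)
      also have "q / (a * q ^ K) * b = q / (a * q ^ (K + i))"
        by (simp add: b' power_add)
      finally show ?thesis
        using qpoch_reverse[OF q(1) a] by simp
    qed
    have B: "qpoch q (b * q ^ (K + 1)) (m - K) = qpoch q q M / qpoch q q L"
    proof -
      have eq: "b * q ^ (K + 1) = q * q ^ L"
        using q by (simp add: b' K_def power_add)
      have "qpoch q q (L + (M - L)) = qpoch q q L * qpoch q (q * q ^ L) (M - L)"
        by (rule qpoch_add)
      thus ?thesis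
        unfolding eq mK using nz[of L] that by (simp add: field_simps)
    qed
    have a1: "a * q ^ (K + m + 1) = (a * q ^ (2 * i)) * q ^ (L + M + 1)"
    proof -
      have "K + m + 1 = 2 * i + (L + M + 1)"
        by (simp add: K_def m)
      thus ?thesis by (simp only: power_add mult.assoc)
    qed
    have a2: "a * q ^ (2 * K) = (a * q ^ (2 * i)) * q ^ (2 * L)"
      by (simp add: K_def power_add ring_distribs mult_ac)
    \<comment> \<open>Since K + i = 2i + L, the product can be split again at 2i: (a)_(2i) leaves
      the sum over L.\<close>
    have a3: "qpoch q a K * qpoch q (a * q ^ K) i = qpoch q a (2 * i) * qpoch q (a * q ^ (2 * i)) L"
    proof -
      have "qpoch q a (K + i) = qpoch q a (2 * i + L)"
        by (simp add: K_def mult_2 add_ac)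
      thus ?thesis by (simp only: qpoch_add)
    qed
    have e: "(K choose 2) + K\<^sup>2 = (i * K + (i choose 2)) + (2 * i * L + ((L choose 2) + L\<^sup>2))"
    proof -
      have "K choose 2 = (i choose 2) + (L choose 2) + i * L"
        using choose_2_add[of i L] by (simp only: K_def add.commute)
      thus ?thesis
        by (simp add: K_def power2_eq_square algebra_simps)
    qed
    have a4: "(- a) ^ K * q ^ ((K choose 2) + K\<^sup>2) =
        ((- a) ^ i * q ^ (i * K + (i choose 2))) * ((- (a * q ^ (2 * i))) ^ L * q ^ ((L choose 2) + L\<^sup>2))"
    proof -
      have "(- (a * q ^ (2 * i))) ^ L = (- a) ^ L * q ^ (2 * i * L)"
        by (simp add: power_mult flip: power_mult_distrib)
      moreover have "(- a) ^ K = (- a) ^ L * (- a) ^ i"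
        by (simp add: K_def power_add)
      ultimately show ?thesis
        unfolding e by (simp only: power_add mult_ac)
    qed
    have "f K = (1 - a * q ^ (2 * K)) * qpoch q a K * ((- a) ^ K * q ^ ((K choose 2) + K\<^sup>2))
        * qpoch q (a * q ^ (K + m + 1)) (m - K) / qpoch q q (m - K) * (bsum q a b K * (qpoch q q M / qpoch q q L))"
      unfolding f_def bailey_term_def B by (simp only: mult.assoc)
    also have "\<dots> = (1 - a * q ^ (2 * K)) * (qpoch q a K *
        (bsum q a b K * ((- a) ^ i * q ^ (i * K + (i choose 2))))) * ((- (a * q ^ (2 * i))) ^ L * q ^ ((L choose 2) + L\<^sup>2))
        * qpoch q (a * q ^ (K + m + 1)) (m - K) * (qpoch q q M / (qpoch q q L * qpoch q q (m - K)))"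
      unfolding a4 by (simp add: mult_ac)
    also have "\<dots> = qpoch q a (2 * i) * vwp_term q (a * q ^ (2 * i)) M L"
      unfolding S a3 a1 a2 mK vwp_term_def by (simp add: mult_ac)
    finally show ?thesis by (simp add: K_def)
  qed
  have "(\<Sum>K\<le>m. f K) = (\<Sum>K\<in>{0 + i..M + i}. f K)"
    using low by (intro sum.mono_neutral_right) (auto simp: m not_less[symmetric])
  also have "\<dots> = (\<Sum>L\<in>{0..M}. f (L + i))"
    by (rule sum.shift_bounds_cl_nat_ivl)
  also have "\<dots> = qpoch q a (2 * i) * (\<Sum>L\<le>M. vwp_term q (a * q ^ (2 * i)) M L)"
    unfolding sum_distrib_left atLeast0AtMost by (intro sum.cong) (auto simp: high)
  also have "\<dots> = qpoch q a (2 * i) * qpoch q (a * q ^ (2 * i)) (2 * M + 1)"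
    using q(2) by (simp add: sum_vwp_term)
  also have "\<dots> = qpoch q a (2 * m + 1)"
    by (simp add: m ring_distribs flip: qpoch_add) (simp add: add_ac)
  finally show ?thesis
    by (simp add: f_def)
qed

lemma qpoch_poly:
  "\<exists>p. degree p \<le> k \<and> (\<forall>b. poly p b = qpoch q (b * c) k)"
proof (intro exI conjI allI)
  have "degree (\<Prod>i\<in>{..<k}. [:1, - c * q ^ i:]) \<le> card {..<k}"
    by (rule prod_linear_poly) auto
  thus "degree (\<Prod>i<k. [:1, - c * q ^ i:]) \<le> k" by simp
  show "poly (\<Prod>i<k. [:1, - c * q ^ i:]) b = qpoch q (b * c) k" for b
    by (simp add: qpoch_def poly_prod mult_ac)
qed

text \<open>Both sides are polynomials in \<open>b\<close> of degree at most \<open>m\<close>. At \<open>b = q\<^bsup>-i\<^esup>\<close> with \<open>i \<le> m\<close> the inner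
  sum closes up by the q-binomial theorem.\<close>

lemma sum_bailey:
  assumes q: "q \<noteq> 0" "cmod q < 1" and a: "a \<noteq> 0"
  shows "(\<Sum>K\<le>m. bailey_term q a m K * (bsum q a b K * qpoch q (b * q ^ (K + 1)) (m - K))) = qpoch q a (2 * m + 1)"
proof -
  have "\<forall>k c. \<exists>p. degree p \<le> k \<and> (\<forall>b. poly p b = qpoch q (b * c) k)"
    using qpoch_poly by blast
  then obtain p where p: "\<And>k c. degree (p k c) \<le> k" "\<And>k c b. poly (p k c) b = qpoch q (b * c) k"
    by metis
  define s where "s = (\<lambda>K. \<Sum>J\<le>K. Polynomial.smult ((q / (a * q ^ K)) ^ J / qpoch q q J) (p J 1))"
  define P where "P = (\<Sum>K\<le>m. Polynomial.smult (bailey_term q a m K) (s K * p (m - K) (q ^ (K + 1))))"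
  have s: "degree (s K) \<le> K" "poly (s K) b = bsum q a b K" for K b
  proof -
    show "degree (s K) \<le> K"
      unfolding s_def using p(1) by (intro degree_sum_le) (auto intro!: order.trans[OF degree_smult_le] intro: order.trans)
    show "poly (s K) b = bsum q a b K"
      by (simp add: s_def bsum_def poly_sum p(2) mult_ac)
  qed
  have P: "poly P b = (\<Sum>K\<le>m. bailey_term q a m K * (bsum q a b K * qpoch q (b * q ^ (K + 1)) (m - K)))" for b
    by (simp add: P_def poly_sum s(2) p(2))
  have inj: "inj_on (\<lambda>i. 1 / q ^ i) {..m}"
  proof (rule inj_onI)
    have *: "i = j" if "q ^ i = q ^ j" "i \<le> j" for i j
    proof (rule ccontr)
      assume "i \<noteq> j"
      with that have "j - i > 0" by simp
      have "q ^ i * q ^ (j - i) = q ^ i * 1"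
        unfolding power_add[symmetric] le_add_diff_inverse[OF that(2)] using that(1) by simp
      hence "q ^ (j - i) = 1" using q by simp
      thus False using power_neq_1[OF q(2) \<open>j - i > 0\<close>] by simp
    qed
    fix i j assume "1 / q ^ i = 1 / q ^ j"
    thus "i = j" using *[of i j] *[of j i] q by (cases "i \<le> j") auto
  qed
  have "P = [:qpoch q a (2 * m + 1):]"
  proof (rule poly_eqI_degree)
    fix b assume "b \<in> (\<lambda>i. 1 / q ^ i) ` {..m}"
    then obtain i where "i \<le> m" "b * q ^ i = 1"
      using q by auto
    thus "poly P b = poly [:qpoch q a (2 * m + 1):] b"
      unfolding P using sum_bailey_at_power[OF q a] by simp
  next
    \<comment> \<open>The bounds K from \<open>bsum\<close> and m - K from the product add up to m
      for every K.\<close>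
    have "degree (s K * p (m - K) (q ^ (K + 1))) \<le> m" if "K \<le> m" for K
    proof -
      have "degree (s K * p (m - K) (q ^ (K + 1))) \<le> K + (m - K)"
        by (rule order.trans[OF degree_mult_le]) (intro add_mono s p)
      thus ?thesis using that by simp
    qed
    hence "degree P \<le> m"
      unfolding P_def by (intro degree_sum_le) (auto intro!: order.trans[OF degree_smult_le])
    also have "m < card ((\<lambda>i. 1 / q ^ i) ` {..m})"
      using inj by (simp add: card_image)
    finally show "degree P < card ((\<lambda>i. 1 / q ^ i) ` {..m})" .
    show "degree [:qpoch q a (2 * m + 1):] < card ((\<lambda>i. 1 / q ^ i) ` {..m})"
      using inj by (simp add: card_image)
  qed
  thus ?thesis
    using P[of b] by simp
qed

section \<open>The one-variable identity\<close>

lemma convergent_prod_qpoch: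
  assumes "cmod q < 1"
  shows "convergent_prod (\<lambda>i. 1 - z * q ^ i)"
proof -
  have "summable (\<lambda>i. norm ((1 - z * q ^ i) - 1))"
    using assms by (simp add: norm_mult norm_power summable_mult)
  thus ?thesis
    by (intro abs_convergent_prod_imp_convergent_prod summable_imp_abs_convergent_prod)
qed

lemma qpoch_tendsto:
  assumes "cmod q < 1"
  shows "qpoch q z \<longlonglongrightarrow> qpoch_inf q z"
  using convergent_prod_LIMSEQ[OF convergent_prod_qpoch[OF assms, of z]]
  unfolding qpoch_inf_def qpoch_def[abs_def] LIMSEQ_lessThan_iff_atMost .

lemma qpoch_inf_split:
  assumes "cmod q < 1"
  shows "qpoch_inf q z = qpoch q z k * qpoch_inf q (z * q ^ k)"
proof (rule LIMSEQ_unique)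
  show "(\<lambda>N. qpoch q z (k + N)) \<longlonglongrightarrow> qpoch_inf q z"
    using LIMSEQ_ignore_initial_segment[OF qpoch_tendsto[OF assms], of z k] by (simp add: add.commute)
  show "(\<lambda>N. qpoch q z (k + N)) \<longlonglongrightarrow> qpoch q z k * qpoch_inf q (z * q ^ k)"
    unfolding qpoch_add by (intro tendsto_intros qpoch_tendsto assms)
qed

lemma qpoch_inf_nonzero:
  assumes "cmod q < 1" "\<And>i. z * q ^ i \<noteq> 1"
  shows "qpoch_inf q z \<noteq> 0"
  unfolding qpoch_inf_def using assms(2)
  by (intro prodinf_nonzero convergent_prod_qpoch assms) (metis eq_iff_diff_eq_0)

lemma qpoch_nonzero:
  assumes "cmod q < 1" "qpoch_inf q z \<noteq> 0"
  shows "qpoch q z k \<noteq> 0"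
  using qpoch_inf_split[OF assms(1), of z k] assms(2) by auto

text \<open>The bound is uniform in \<open>k\<close>: each factor has norm at most 1 + R |q|^i, and
  1 + t <= exp t leads to a geometric sum in the exponent.\<close>

lemma norm_qpoch_le:
  assumes "cmod q < 1" "norm z \<le> R"
  shows "norm (qpoch q z k) \<le> exp (R / (1 - cmod q))"
proof -
  have "norm (qpoch q z k) \<le> (\<Prod>i<k. 1 + R * cmod q ^ i)"
    unfolding qpoch_def prod_norm[symmetric]
  proof (intro prod_mono conjI)
    fix i
    have "norm (1 - z * q ^ i) \<le> norm (1 :: complex) + norm (z * q ^ i)"
      by (rule norm_triangle_ineq4)
    also have "norm (z * q ^ i) \<le> R * cmod q ^ i"
      using assms by (simp add: norm_mult norm_power mult_right_mono)
    finally show "norm (1 - z * q ^ i) \<le> 1 + R * cmod q ^ i"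
      by simp
  qed auto
  also have R: "R \<ge> 0"
    using assms(2) norm_ge_zero[of z] by linarith
  hence "(\<Prod>i<k. 1 + R * cmod q ^ i) \<le> exp (\<Sum>i<k. R * cmod q ^ i)"
    by (intro prod_le_exp_sum) auto
  also have "(\<Sum>i<k. R * cmod q ^ i) \<le> (\<Sum>i. R * cmod q ^ i)"
    using assms R by (intro sum_le_suminf summable_mult) auto
  also have "(\<Sum>i. R * cmod q ^ i) = R / (1 - cmod q)"
    using assms by (simp add: suminf_mult suminf_geometric)
  finally show ?thesis by simp
qed

lemma norm_qpoch_inf_le:
  assumes "cmod q < 1" "norm z \<le> R"
  shows "norm (qpoch_inf q z) \<le> exp (R / (1 - cmod q))"
  using norm_qpoch_le[OF assms]
  by (intro tendsto_upperbound[OF tendsto_norm[OF qpoch_tendsto[OF assms(1)]]]) auto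

text \<open>The inverses converge because the limit of the products is nonzero. This controls
  denominators uniformly in the summation index.\<close>

lemma inverse_qpoch_bounded:
  assumes "cmod q < 1" "qpoch_inf q z \<noteq> 0"
  obtains C where "C > 0" "\<And>k. norm (inverse (qpoch q z k)) \<le> C"
proof -
  have "(\<lambda>k. inverse (qpoch q z k)) \<longlonglongrightarrow> inverse (qpoch_inf q z)"
    using assms by (intro tendsto_intros qpoch_tendsto)
  hence "Bseq (\<lambda>k. inverse (qpoch q z k))"
    by (intro convergent_imp_Bseq) (auto simp: convergent_def)
  thus ?thesis
    using that unfolding Bseq_def by auto
qed

lemma uniform_limit_qpoch:
  assumes "cmod q < 1"
  shows "uniform_limit (cball 0 R) (\<lambda>N z. qpoch q z N) (qpoch_inf q) sequentially"
proof -
  have "uniformly_convergent_on (cball 0 R) (\<lambda>N z. \<Prod>i<N. 1 - z * q ^ i)"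
  proof (rule uniformly_convergent_on_prod')
    show "uniformly_convergent_on (cball 0 R) (\<lambda>N z. \<Sum>i<N. norm (1 - z * q ^ i - 1))"
    proof (rule Weierstrass_m_test')
      show "summable (\<lambda>i. R * cmod q ^ i)"
        using assms by (intro summable_mult) simp
      show "norm (norm (1 - z * q ^ i - 1)) \<le> R * cmod q ^ i" if "z \<in> cball 0 R" for z i
        using that by (simp add: norm_mult norm_power mult_right_mono)
    qed
  qed (auto intro!: continuous_intros)
  then obtain l where l: "uniform_limit (cball 0 R) (\<lambda>N z. qpoch q z N) l sequentially"
    unfolding uniformly_convergent_on_def qpoch_def by blast
  have "l z = qpoch_inf q z" if "z \<in> cball 0 R" for z
    using tendsto_uniform_limitI[OF l that] qpoch_tendsto[OF assms, of z] by (rule LIMSEQ_unique)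
  hence "uniform_limit (cball 0 R) (\<lambda>N z. qpoch q z N) (qpoch_inf q) sequentially
      \<longleftrightarrow> uniform_limit (cball 0 R) (\<lambda>N z. qpoch q z N) l sequentially"
    by (intro uniform_limit_cong') auto
  thus ?thesis
    using l by blast
qed

lemma holomorphic_qpoch_inf:
  assumes "cmod q < 1"
  shows "qpoch_inf q holomorphic_on UNIV"
proof (rule holomorphic_uniform_sequence[of _ "\<lambda>N z. qpoch q z N"])
  show "(\<lambda>z. qpoch q z N) holomorphic_on UNIV" for N
    unfolding qpoch_def by (intro holomorphic_intros)
  fix z :: complex
  have "cball z 1 \<subseteq> cball 0 (norm z + 1)"
    by (metis cball_subset_cball_iff diff_0_right dist_0_norm dist_commute order.refl)
  hence "uniform_limit (cball z 1) (\<lambda>N z. qpoch q z N) (qpoch_inf q) sequentially"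
    using uniform_limit_qpoch[OF assms] by (rule uniform_limit_on_subset[rotated])
  thus "\<exists>d>0. cball z d \<subseteq> UNIV \<and> uniform_limit (cball z d) (\<lambda>N z. qpoch q z N) (qpoch_inf q) sequentially"
    by (intro exI[of _ 1]) auto
qed auto

lemma holomorphic_qpoch_inf_scaled:
  assumes "cmod q < 1"
  shows "(\<lambda>u. qpoch_inf q (c * u)) holomorphic_on A"
proof -
  have "(qpoch_inf q \<circ> (\<lambda>u. c * u)) holomorphic_on A"
    by (rule holomorphic_on_compose_gen[OF _ holomorphic_qpoch_inf[OF assms]]) (auto intro!: holomorphic_intros)
  thus ?thesis by (simp add: o_def)
qed

text \<open>\<open>nprod q u K = (Y)\<^sub>K u\<^bsup>K\<^esup>\<close> for \<open>u = 1/Y\<close>, so \<open>ncoeff\<close> collects what does not depend on \<open>Y\<close>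
  except for the denominator \<open>(aqu)\<^sub>K\<close>.\<close>

definition ncoeff :: "complex \<Rightarrow> complex \<Rightarrow> complex \<Rightarrow> nat \<Rightarrow> complex" where
  "ncoeff q a b K = (1 - a * q ^ (2 * K)) * qpoch q a K * a ^ K * q ^ (K\<^sup>2) * bsum q a b K
     / ((1 - a) * qpoch q (b * q) K)"

definition nprod :: "complex \<Rightarrow> complex \<Rightarrow> nat \<Rightarrow> complex" where
  "nprod q u K = (\<Prod>i<K. u - q ^ i)"

lemma nprod_eq_qpoch:
  assumes "Y * u = 1"
  shows "nprod q u K = qpoch q Y K * u ^ K"
proof -
  have "u - q ^ i = (1 - Y * q ^ i) * u" for i
    using assms by (simp add: algebra_simps)
  thus ?thesis
    by (simp add: nprod_def qpoch_def prod.distrib)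
qed

text \<open>The new factor q^m - q^K equals -q^K (1 - q^(m-K)), and 1 - q^(m-K) cancels the last
  factor of the denominator (q)_(m-K).\<close>

lemma nprod_at_power:
  assumes q: "cmod q < 1" and "K \<le> m"
  shows "nprod q (q ^ m) K = (- 1) ^ K * q ^ (K choose 2) * qpoch q q m / qpoch q q (m - K)"
  using \<open>K \<le> m\<close>
proof (induction K)
  case 0
  thus ?case using qpoch_q_nonzero[OF q] by (simp add: nprod_def binomial_eq_0)
next
  case (Suc K)
  then obtain d where d: "m = K + Suc d"
    by (metis less_iff_Suc_add add_Suc_right Suc_le_eq)
  have "nprod q (q ^ m) (Suc K) = nprod q (q ^ m) K * (q ^ m - q ^ K)"
    by (simp add: nprod_def)
  also have "nprod q (q ^ m) K = (- 1) ^ K * q ^ (K choose 2) * qpoch q q m / (qpoch q q d * (1 - q ^ Suc d))"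
    using Suc by (simp add: d qpoch_Suc)
  also have "q ^ m - q ^ K = - (q ^ K) * (1 - q ^ Suc d)"
    by (simp add: d power_add algebra_simps)
  also have "(- 1) ^ K * q ^ (K choose 2) * qpoch q q m / (qpoch q q d * (1 - q ^ Suc d)) * (- (q ^ K) * (1 - q ^ Suc d))
      = (- 1) ^ Suc K * q ^ (Suc K choose 2) * qpoch q q m / qpoch q q (m - Suc K)"
    using power_neq_1[OF q, of "Suc d"] by (simp add: d Suc_choose_2 power_add)
  finally show ?case .
qed

text \<open>Taking r out of each factor leaves 1 + |q|^i / r, whose product is bounded. So the
  Newton products are O(r^K) on the whole disc, and summability at radius r yields a Weierstrass
  majorant.\<close>

lemma norm_nprod_le:
  assumes q: "cmod q < 1" and r: "r > 0" "norm u \<le> r"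
  shows "norm (nprod q u K) \<le> r ^ K * exp (1 / r / (1 - cmod q))"
proof -
  have "norm (nprod q u K) \<le> (\<Prod>i<K. r * (1 + 1 / r * cmod q ^ i))"
    unfolding nprod_def prod_norm[symmetric]
  proof (intro prod_mono conjI)
    fix i
    have "norm (u - q ^ i) \<le> norm u + norm (q ^ i)"
      by (rule norm_triangle_ineq4)
    also have "\<dots> \<le> r * (1 + 1 / r * cmod q ^ i)"
      using r by (simp add: norm_power field_simps)
    finally show "norm (u - q ^ i) \<le> r * (1 + 1 / r * cmod q ^ i)" .
  qed auto
  also have "\<dots> = r ^ K * (\<Prod>i<K. 1 + 1 / r * cmod q ^ i)"
    by (simp add: prod.distrib)
  also have "(\<Prod>i<K. 1 + 1 / r * cmod q ^ i) \<le> exp (\<Sum>i<K. 1 / r * cmod q ^ i)"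
    using r by (intro prod_le_exp_sum) auto
  also have "(\<Sum>i<K. 1 / r * cmod q ^ i) \<le> (\<Sum>i. 1 / r * cmod q ^ i)"
    using q r by (intro sum_le_suminf summable_mult) auto
  also have "(\<Sum>i. 1 / r * cmod q ^ i) = 1 / r / (1 - cmod q)"
    using q by (subst suminf_mult) (auto simp: suminf_geometric)
  finally show ?thesis
    using r by simp
qed

text \<open>The nodes \<open>u = q\<^bsup>m\<^esup>\<close>, where the series terminates, accumulate at the interior point \<open>0\<close>;
  this settles the open disc, and the boundary follows by continuity.\<close>

lemma newton_series:
  assumes q: "0 < cmod q" "cmod q < 1" and a: "a \<noteq> 0" "a \<noteq> 1"
    and b: "qpoch_inf q (b * q) \<noteq> 0"
    and r: "r > 0" and summable: "summable (\<lambda>K. norm (ncoeff q a b K) * r ^ K)"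
    and u: "norm u \<le> r"
  shows "summable (\<lambda>K. ncoeff q a b K * nprod q u K * qpoch_inf q (a * q ^ Suc K * u))"
    and "(\<Sum>K. ncoeff q a b K * nprod q u K * qpoch_inf q (a * q ^ Suc K * u)) * qpoch_inf q (q * u)
      = qpoch_inf q q * qpoch_inf q (a * q) / qpoch_inf q (b * q) * qpoch_inf q (b * q * u)"
proof -
  define t where "t = (\<lambda>K u. ncoeff q a b K * nprod q u K * qpoch_inf q (a * q ^ Suc K * u))"
  define h where "h = (\<lambda>u. \<Sum>K. t K u)"
  \<comment> \<open>The bounds of the Newton product and of the infinite product, where |a q^(K+1)
    u| <= |a| r; neither depends on K.\<close>
  define E where "E = exp (1 / r / (1 - cmod q)) * exp (cmod a * r / (1 - cmod q))"
  have q0: "q \<noteq> 0" using q by auto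
  have bound: "norm (t K u) \<le> norm (ncoeff q a b K) * r ^ K * E" if "u \<in> cball 0 r" for K u
  proof -
    have u: "norm u \<le> r" using that by simp
    have "norm (a * q ^ Suc K * u) = cmod a * cmod q ^ Suc K * norm u"
      by (simp add: norm_mult norm_power)
    also have "\<dots> \<le> cmod a * 1 * r"
      using u q by (intro mult_mono power_le_one) auto
    finally have "norm (qpoch_inf q (a * q ^ Suc K * u)) \<le> exp (cmod a * r / (1 - cmod q))"
      using q by (intro norm_qpoch_inf_le) auto
    moreover have "norm (nprod q u K) \<le> r ^ K * exp (1 / r / (1 - cmod q))"
      using q r u by (intro norm_nprod_le)
    ultimately have "norm (nprod q u K) * norm (qpoch_inf q (a * q ^ Suc K * u)) \<le>
        (r ^ K * exp (1 / r / (1 - cmod q))) * exp (cmod a * r / (1 - cmod q))"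
      using r by (intro mult_mono) auto
    hence "norm (ncoeff q a b K) * (norm (nprod q u K) * norm (qpoch_inf q (a * q ^ Suc K * u))) \<le>
        norm (ncoeff q a b K) * ((r ^ K * exp (1 / r / (1 - cmod q))) * exp (cmod a * r / (1 - cmod q)))"
      by (rule mult_left_mono) auto
    thus ?thesis
      by (simp add: t_def E_def norm_mult mult_ac)
  qed
  have summ: "summable (\<lambda>K. norm (ncoeff q a b K) * r ^ K * E)"
    using summable by (rule summable_mult2)
  show "summable (\<lambda>K. ncoeff q a b K * nprod q u K * qpoch_inf q (a * q ^ Suc K * u))"
    using summable_comparison_test[OF _ summ, of "\<lambda>K. t K u"] bound[of u] u by (auto simp: t_def)
  have ulim: "uniform_limit (cball 0 r) (\<lambda>N u. \<Sum>K<N. t K u) h sequentially"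
    unfolding h_def using bound summ by (rule Weierstrass_m_test)
  have t_hol: "t K holomorphic_on A" for K A
    unfolding t_def nprod_def using q by (intro holomorphic_intros holomorphic_qpoch_inf_scaled)
  have "\<forall>\<^sub>F N in sequentially. continuous_on (cball 0 r) (\<lambda>u. \<Sum>K<N. t K u) \<and> (\<lambda>u. \<Sum>K<N. t K u) holomorphic_on ball 0 r"
    by (intro always_eventually allI conjI holomorphic_on_imp_continuous_on holomorphic_intros t_hol)
  then obtain h_cont: "continuous_on (cball 0 r) h" and h_hol: "h holomorphic_on ball 0 r"
    by (rule holomorphic_uniform_limit[OF _ ulim]) auto
  define c where "c = qpoch_inf q q * qpoch_inf q (a * q) / qpoch_inf q (b * q)"
  define D where "D = (\<lambda>u. h u * qpoch_inf q (q * u) - c * qpoch_inf q (b * q * u))"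
  have D_cont: "continuous_on (cball 0 r) D"
    unfolding D_def using q
    by (intro continuous_intros h_cont holomorphic_on_imp_continuous_on[OF holomorphic_qpoch_inf_scaled])
  have D_hol: "D holomorphic_on ball 0 r"
    unfolding D_def using q by (intro holomorphic_intros h_hol holomorphic_qpoch_inf_scaled)
  have D_pow: "D (q ^ m) = 0" for m
  proof -
    have nzb: "qpoch q (b * q) k \<noteq> 0" for k
      using q b by (intro qpoch_nonzero)
    have nzq: "qpoch q q k \<noteq> 0" for k
      using q by (intro qpoch_q_nonzero)
    \<comment> \<open>\<open>e\<close> collects the factors free of K. Step \<open>2\<close> below
      puts every (bq)_K over the common denominator (bq)_m, which leaves the sum of
      \<open>sum_bailey\<close>.\<close>
    define e where "e = qpoch q q m * qpoch_inf q (a * q ^ (2 * m + 1)) / ((1 - a) * qpoch q (b * q) m)"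
    have "t K (q ^ m) = 0" if "K \<notin> {..m}" for K
    proof -
      have "nprod q (q ^ m) K = 0"
        using that unfolding nprod_def by (intro prod_zero) auto
      thus ?thesis by (simp add: t_def)
    qed
    hence "h (q ^ m) = (\<Sum>K\<le>m. t K (q ^ m))"
      unfolding h_def by (intro suminf_finite) auto
    also have "\<dots> = (\<Sum>K\<le>m. e * (bailey_term q a m K * (bsum q a b K * qpoch q (b * q ^ (K + 1)) (m - K))))"
    proof (intro sum.cong refl)
      fix K assume "K \<in> {..m}"
      then obtain d where d: "m = K + d"
        by (auto simp: le_iff_add)
      have md: "m - K = d" by (simp add: d)
      have 1: "qpoch_inf q (a * q ^ Suc K * q ^ m) = qpoch q (a * q ^ (K + m + 1)) d * qpoch_inf q (a * q ^ (2 * m + 1))"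
        using qpoch_inf_split[OF q(2), of "a * q ^ Suc K * q ^ m" d] unfolding mult_2
        by (simp add: d power_add mult_ac)
      have 2: "1 / qpoch q (b * q) K = qpoch q (b * q ^ (K + 1)) d / qpoch q (b * q) m"
        using nzb[of K] nzb[of m] qpoch_add[of q "b * q" K d] by (simp add: d mult_ac field_simps)
      have 3: "nprod q (q ^ m) K = (- 1) ^ K * q ^ (K choose 2) * qpoch q q m / qpoch q q d"
        using nprod_at_power[OF q(2), of K m] by (simp add: d)
      have 4: "(- a) ^ K = (- 1) ^ K * a ^ K"
        by (simp flip: power_mult_distrib)
      have "t K (q ^ m) = (1 - a * q ^ (2 * K)) * qpoch q a K * a ^ K * q ^ (K\<^sup>2) * bsum q a b K
          / (1 - a) * (1 / qpoch q (b * q) K) * nprod q (q ^ m) K * qpoch_inf q (a * q ^ Suc K * q ^ m)"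
        by (simp add: t_def ncoeff_def)
      also have "\<dots> = e * (bailey_term q a m K * (bsum q a b K * qpoch q (b * q ^ (K + 1)) (m - K)))"
        unfolding 1 2 3 e_def bailey_term_def 4 md power_add[of q "K choose 2"] by (simp add: mult_ac)
      finally show "t K (q ^ m) = e * (bailey_term q a m K * (bsum q a b K * qpoch q (b * q ^ (K + 1)) (m - K)))" .
    qed
    also have "\<dots> = e * qpoch q a (2 * m + 1)"
      unfolding sum_distrib_left[symmetric] using sum_bailey[OF q0 q(2) a(1)] by simp
    also have "\<dots> = qpoch q q m * (qpoch q a (2 * m + 1) * qpoch_inf q (a * q ^ (2 * m + 1))) / ((1 - a) * qpoch q (b * q) m)"
      by (simp add: e_def)
    also have "qpoch q a (2 * m + 1) * qpoch_inf q (a * q ^ (2 * m + 1)) = qpoch_inf q a"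
      using qpoch_inf_split[OF q(2)] by metis
    also have "qpoch_inf q a = (1 - a) * qpoch_inf q (a * q)"
      using qpoch_inf_split[OF q(2), of a 1] by (simp add: qpoch_def)
    finally have h: "h (q ^ m) = qpoch q q m * qpoch_inf q (a * q) / qpoch q (b * q) m"
      using a by simp
    have "h (q ^ m) * qpoch_inf q (q * q ^ m) = qpoch_inf q q * qpoch_inf q (a * q) / qpoch q (b * q) m"
      unfolding h using qpoch_inf_split[OF q(2), of q m] by simp
    also have "\<dots> = c * qpoch_inf q (b * q * q ^ m)"
      using b nzb[of m] qpoch_inf_split[OF q(2), of "b * q" m] by (simp add: c_def field_simps)
    finally show ?thesis by (simp add: D_def)
  qed
  have "(\<lambda>m. q ^ m) \<longlonglongrightarrow> 0"
    using q by (intro LIMSEQ_power_zero) auto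
  hence "\<forall>\<^sub>F m in sequentially. dist (q ^ m) 0 < r"
    using r by (rule tendstoD)
  \<comment> \<open>\<open>r\<close> may be less than 1, so only a tail of the powers is sure to lie
    in the disc.\<close>
  then obtain m0 where m0: "\<And>m. m \<ge> m0 \<Longrightarrow> dist (q ^ m) 0 < r"
    unfolding eventually_sequentially by blast
  have limpt: "0 islimpt (\<lambda>m. q ^ m) ` {m0..}"
    unfolding islimpt_sequential
  proof (intro exI[of _ "\<lambda>m. q ^ (m + m0)"] conjI allI)
    show "(\<lambda>m. q ^ (m + m0)) \<longlonglongrightarrow> 0"
      by (rule LIMSEQ_ignore_initial_segment) fact
  qed (use q0 in auto)
  have D_ball: "D z = 0" if "z \<in> ball 0 r" for z
    by (rule analytic_continuation[OF D_hol, of "(\<lambda>m. q ^ m) ` {m0..}" 0])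
       (use r m0 limpt D_pow that in \<open>auto simp: dist_commute\<close>)
  have "D u = 0"
  proof (rule continuous_constant_on_closure[of "ball 0 r" D 0 u])
    show "continuous_on (closure (ball 0 r)) D"
      using D_cont r by simp
    show "u \<in> closure (ball 0 r)"
      using u r by simp
  qed (use D_ball in auto)
  thus "(\<Sum>K. ncoeff q a b K * nprod q u K * qpoch_inf q (a * q ^ Suc K * u)) * qpoch_inf q (q * u)
      = qpoch_inf q q * qpoch_inf q (a * q) / qpoch_inf q (b * q) * qpoch_inf q (b * q * u)"
    by (simp add: D_def h_def t_def c_def)
qed

lemma one_variable_sums:
  assumes q: "0 < cmod q" "cmod q < 1" and a: "a \<noteq> 0" "a \<noteq> 1"
    and b: "qpoch_inf q (b * q) \<noteq> 0"
    and u: "u \<noteq> 0" "qpoch_inf q (a * q * u) \<noteq> 0" "qpoch_inf q (q * u) \<noteq> 0"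
    and summable: "summable (\<lambda>K. norm (ncoeff q a b K) * norm u ^ K)"
  shows "(\<lambda>K. ncoeff q a b K * nprod q u K / qpoch q (a * q * u) K) sums
     (qpoch_inf q q * qpoch_inf q (a * q) * qpoch_inf q (b * q * u)
       / (qpoch_inf q (a * q * u) * qpoch_inf q (b * q) * qpoch_inf q (q * u)))"
proof -
  define t where "t = (\<lambda>K. ncoeff q a b K * nprod q u K * qpoch_inf q (a * q ^ Suc K * u))"
  have "norm u > 0" using u by simp
  note ns = newton_series[OF q a b this summable order.refl, folded t_def]
  have "ncoeff q a b K * nprod q u K / qpoch q (a * q * u) K = t K / qpoch_inf q (a * q * u)" for K
  proof -
    have "qpoch_inf q (a * q * u) = qpoch q (a * q * u) K * qpoch_inf q (a * q ^ Suc K * u)"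
      using qpoch_inf_split[OF q(2), of "a * q * u" K] by (simp add: mult_ac)
    thus ?thesis
      using u(2) by (simp add: t_def)
  qed
  moreover have "(\<lambda>K. t K / qpoch_inf q (a * q * u)) sums (suminf t / qpoch_inf q (a * q * u))"
    using ns(1) by (intro sums_divide summable_sums)
  moreover have "suminf t = qpoch_inf q q * qpoch_inf q (a * q) / qpoch_inf q (b * q) * qpoch_inf q (b * q * u) / qpoch_inf q (q * u)"
    using ns(2) u(3) by (metis nonzero_mult_div_cancel_right)
  ultimately show ?thesis
    by (simp add: mult_ac)
qed

text \<open>In \<open>a\<^bsup>K\<^esup> q\<^bsup>K\<^sup>2\<^esup> bsum q a b K\<close> the last summand, of size \<open>q\<^bsup>K\<^esup>\<close>, dominates a geometric sum of ratio
  \<open>a q\<^bsup>K-1\<^esup>\<close>.\<close>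

lemma ncoeff_bound:
  assumes q: "0 < cmod q" "cmod q < 1" and a: "a \<noteq> 0" and b: "qpoch_inf q (b * q) \<noteq> 0"
  obtains C where "C > 0" "\<And>K. norm (ncoeff q a b K) \<le> C * cmod q ^ K"
proof -
  have q0: "q \<noteq> 0" using q by auto
  have "q * q ^ i \<noteq> 1" for i
    using power_neq_1[OF q(2), of "Suc i"] by simp
  hence "qpoch_inf q q \<noteq> 0"
    using q by (intro qpoch_inf_nonzero)
  with q obtain C1 where C1: "C1 > 0" "\<And>k. norm (inverse (qpoch q q k)) \<le> C1"
    using inverse_qpoch_bounded by metis
  obtain C2 where C2: "C2 > 0" "\<And>k. norm (inverse (qpoch q (b * q) k)) \<le> C2"
    using inverse_qpoch_bounded[OF q(2) b] by metis
  define Ea where "Ea = exp (cmod a / (1 - cmod q))"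
  define Eb where "Eb = exp (cmod b / (1 - cmod q))"
  have Ea: "norm (qpoch q a k) \<le> Ea" and Eb: "norm (qpoch q b k) \<le> Eb" for k
    using norm_qpoch_le[OF q(2)] by (auto simp: Ea_def Eb_def)
  \<comment> \<open>This is |a| |q|^(K-1), written as a quotient to cover K = 0. Up to bounded
    factors the summand J has size |q|^K times \<open>d K ^ (K - J)\<close>.\<close>
  define d where "d = (\<lambda>K. cmod a * cmod q ^ K / cmod q)"
  have d_nonneg: "d K \<ge> 0" for K
    by (simp add: d_def)
  have geo: "norm (a ^ K * q ^ (K\<^sup>2) * bsum q a b K) \<le> Eb * C1 * cmod q ^ K * (\<Sum>i\<le>K. d K ^ i)" for K
  proof -
    have "norm (a ^ K * q ^ (K\<^sup>2) * bsum q a b K)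
        = norm (\<Sum>J\<le>K. a ^ K * q ^ (K\<^sup>2) * (qpoch q b J / qpoch q q J * (q / (a * q ^ K)) ^ J))"
      by (simp add: bsum_def sum_distrib_left)
    also have "\<dots> \<le> (\<Sum>J\<le>K. Eb * C1 * cmod q ^ K * d K ^ (K - J))"
    proof (rule sum_norm_le)
      fix J assume "J \<in> {..K}"
      then obtain i where i: "K = J + i"
        by (auto simp: le_iff_add)
      have "norm (a ^ K * q ^ (K\<^sup>2) * (q / (a * q ^ K)) ^ J) = cmod q ^ K * d K ^ i"
      proof -
        have "K\<^sup>2 = K * J + K * i"
          by (simp add: i power2_eq_square ring_distribs)
        hence "a ^ K * q ^ (K\<^sup>2) * (q / (a * q ^ K)) ^ J * q ^ i = (q ^ J * q ^ i) * (a * q ^ K) ^ i"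
          using a q0 by (simp add: i power_add power_mult_distrib power_divide power_mult)
        also have "q ^ J * q ^ i = q ^ K"
          by (simp add: i power_add)
        finally have "norm (a ^ K * q ^ (K\<^sup>2) * (q / (a * q ^ K)) ^ J) * cmod q ^ i = cmod q ^ K * (cmod a * cmod q ^ K) ^ i"
          by (metis norm_mult norm_power)
        thus ?thesis
          using q by (simp add: d_def power_divide field_simps)
      qed
      moreover have "norm (qpoch q b J / qpoch q q J) \<le> Eb * C1"
        unfolding divide_inverse norm_mult by (intro mult_mono Eb C1(2)) (auto simp: Eb_def)
      ultimately have "norm (qpoch q b J / qpoch q q J) * norm (a ^ K * q ^ (K\<^sup>2) * (q / (a * q ^ K)) ^ J)
          \<le> (Eb * C1) * (cmod q ^ K * d K ^ i)"
        using d_nonneg C1(1) by (intro mult_mono) (auto simp: Eb_def)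
      thus "norm (a ^ K * q ^ (K\<^sup>2) * (qpoch q b J / qpoch q q J * (q / (a * q ^ K)) ^ J))
          \<le> Eb * C1 * cmod q ^ K * d K ^ (K - J)"
        by (simp add: i norm_mult norm_divide mult_ac)
    qed
    also have "\<dots> = Eb * C1 * cmod q ^ K * (\<Sum>J\<le>K. d K ^ (K - J))"
      by (simp add: sum_distrib_left)
    also have "(\<Sum>J\<le>K. d K ^ (K - J)) = (\<Sum>i\<le>K. d K ^ i)"
      by (rule sum.reindex_bij_witness[of _ "\<lambda>i. K - i" "\<lambda>i. K - i"]) auto
    finally show ?thesis .
  qed
  \<comment> \<open>\<open>d K\<close> may exceed 1 for small K, but it tends to 0; once it is below
    1/2 the sums are at most 2.\<close>
  have "Bseq (\<lambda>K. \<Sum>i\<le>K. d K ^ i)"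
  proof (rule BfunI)
    have "d \<longlonglongrightarrow> cmod a * 0 / cmod q"
      unfolding d_def using q by (intro tendsto_intros LIMSEQ_power_zero) auto
    hence "\<forall>\<^sub>F K in sequentially. d K < 1 / 2"
      by (rule order_tendstoD) simp
    thus "\<forall>\<^sub>F K in sequentially. norm (\<Sum>i\<le>K. d K ^ i) \<le> 2"
    proof eventually_elim
      case (elim K)
      have "(\<Sum>i\<le>K. d K ^ i) \<le> (\<Sum>i\<le>K. (1 / 2) ^ i)"
        using elim d_nonneg by (intro sum_mono power_mono) auto
      also have "\<dots> \<le> (\<Sum>i. (1 / 2) ^ i)"
        by (intro sum_le_suminf) auto
      also have "\<dots> = 2"
        by (simp add: suminf_geometric)
      finally show ?case
        using d_nonneg by (simp add: sum_nonneg)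
    qed
  qed
  then obtain C3 where C3: "C3 > 0" "\<And>K. norm (\<Sum>i\<le>K. d K ^ i) \<le> C3"
    unfolding Bseq_def by auto
  define C where "C = (1 + cmod a) * Ea * (Eb * C1 * C3) / cmod (1 - a) * C2"
  have "norm (ncoeff q a b K) \<le> C * cmod q ^ K" for K
  proof -
    have "norm (1 - a * q ^ (2 * K)) \<le> norm (1::complex) + norm (a * q ^ (2 * K))"
      by (rule norm_triangle_ineq4)
    also have "norm (a * q ^ (2 * K)) \<le> cmod a * 1"
      unfolding norm_mult norm_power using q by (intro mult_left_mono power_le_one) auto
    finally have 1: "norm (1 - a * q ^ (2 * K)) \<le> 1 + cmod a" by simp
    have 2: "norm (a ^ K * q ^ (K\<^sup>2) * bsum q a b K) \<le> Eb * C1 * cmod q ^ K * C3"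
      using C3(2)[of K] C1
      by (intro order.trans[OF geo] mult_left_mono) (auto simp: Eb_def)
    have "norm (ncoeff q a b K) = norm (1 - a * q ^ (2 * K)) * norm (qpoch q a K)
        * norm (a ^ K * q ^ (K\<^sup>2) * bsum q a b K) / cmod (1 - a) * norm (inverse (qpoch q (b * q) K))"
      by (simp add: ncoeff_def norm_mult norm_divide norm_inverse divide_inverse mult_ac)
    also have "\<dots> \<le> (1 + cmod a) * Ea * (Eb * C1 * cmod q ^ K * C3) / cmod (1 - a) * C2"
      using 1 2 Ea C2 C1 C3(1)
      by (intro mult_mono divide_right_mono) (auto simp: Ea_def Eb_def)
    also have "\<dots> = C * cmod q ^ K"
      by (simp add: C_def mult_ac)
    finally show ?thesis .
  qed
  hence "norm (ncoeff q a b K) \<le> (\<bar>C\<bar> + 1) * cmod q ^ K" for K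
    by (rule order.trans) (intro mult_right_mono, auto)
  moreover have "\<bar>C\<bar> + 1 > 0" by simp
  ultimately show ?thesis using that by blast
qed

section \<open>Reduction of the multiple series\<close>

text \<open>Each \<open>k s\<close> is counted once for every r < s. This distributes the power of q
  in the outer term over the pairs, one factor \<open>q ^ k s\<close> for each.\<close>

lemma sum_upper_triangle:
  "(\<Sum>r = 1..n. \<Sum>s\<in>{r<..n}. k s) = (\<Sum>s = 1..n. (s - 1) * k s)" for k :: "nat \<Rightarrow> nat"
proof (induction n)
  case 0
  show ?case by simp
next
  case (Suc n)
  have "(\<Sum>r = 1..Suc n. \<Sum>s\<in>{r<..Suc n}. k s) = (\<Sum>r = 1..n. \<Sum>s\<in>{r<..Suc n}. k s)"
    by simp
  also have "\<dots> = (\<Sum>r = 1..n. (\<Sum>s\<in>{r<..n}. k s) + k (Suc n))"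
  proof (intro sum.cong refl)
    fix r assume "r \<in> {1..n}"
    hence "{r<..Suc n} = insert (Suc n) {r<..n}" by auto
    thus "(\<Sum>s\<in>{r<..Suc n}. k s) = (\<Sum>s\<in>{r<..n}. k s) + k (Suc n)" by simp
  qed
  also have "\<dots> = (\<Sum>s = 1..Suc n. (s - 1) * k s)"
    using Suc.IH by (simp add: sum.distrib)
  finally show ?case .
qed

context generic_nodes
begin

text \<open>The factor \<open>q ^ k s\<close> of a pair clears the possibly negative power in
  \<open>vfactor\<close> and leaves a quotient of node differences.\<close>

lemma vfactor_eq:
  "vfactor n q x k * q ^ (\<Sum>r = 1..n. (r - 1) * k r) = vdm n (\<lambda>r. x r * q ^ k r) / vdm n x"
proof -
  have "q ^ (\<Sum>r = 1..n. (r - 1) * k r) = (\<Prod>r = 1..n. \<Prod>s\<in>{r<..n}. q ^ k s)"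
    unfolding sum_upper_triangle[symmetric] power_sum ..
  hence "vfactor n q x k * q ^ (\<Sum>r = 1..n. (r - 1) * k r) =
      (\<Prod>r = 1..n. \<Prod>s\<in>{r<..n}. (1 - q powi (int (k r) - int (k s)) * (x r / x s)) / (1 - x r / x s) * q ^ k s)"
    unfolding vfactor_def by (simp only: prod.distrib)
  also have "\<dots> = (\<Prod>r = 1..n. \<Prod>s\<in>{r<..n}. (x r * q ^ k r - x s * q ^ k s) / (x r - x s))"
  proof (intro prod.cong refl)
    fix r s assume rs: "r \<in> {1..n}" "s \<in> {r<..n}"
    hence nz: "x s \<noteq> 0" "x r - x s \<noteq> 0"
      using x_nz[of s] x_neq[of r s] by auto
    have "(1 - q powi (int (k r) - int (k s)) * (x r / x s)) * q ^ k s = (x s * q ^ k s - x r * q ^ k r) / x s"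
      using nz by (simp add: power_int_diff field_simps)
    moreover have "1 - x r / x s = (x s - x r) / x s"
      using nz by (simp add: field_simps)
    ultimately have "(1 - q powi (int (k r) - int (k s)) * (x r / x s)) / (1 - x r / x s) * q ^ k s
        = ((x s * q ^ k s - x r * q ^ k r) / x s) / ((x s - x r) / x s)"
      by (metis times_divide_eq_left)
    also have "\<dots> = (x r * q ^ k r - x s * q ^ k s) / (x r - x s)"
      using nz by (simp add: divide_simps) (simp add: algebra_simps)
    finally show "(1 - q powi (int (k r) - int (k s)) * (x r / x s)) / (1 - x r / x s) * q ^ k s
        = (x r * q ^ k r - x s * q ^ k s) / (x r - x s)" .
  qed
  also have "\<dots> = vdm n (\<lambda>r. x r * q ^ k r) / vdm n x"
    by (simp add: vdm_def prod_dividef)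
  finally show ?thesis .
qed

lemma mweight_eq:
  "vfactor n q x k * (\<Prod>r = 1..n. \<Prod>s = 1..n. qpoch q (c s * (x r / x s)) (k r) / qpoch q (q * (x r / x s)) (k r))
     * q ^ (\<Sum>r = 1..n. (r - 1) * k r) = mweight n q x c k"
  unfolding mweight_def vfactor_eq[symmetric] by (simp only: mult_ac)

text \<open>With parameters q^(-k_s) the weights vanish outside the box j <= k, so the box may be
  replaced by all multi-indices of each size J. The sum of the weights then contains (q^(-|k|))_J,
  which cancels the denominator.\<close>

lemma inner_sum_eq: "inner_sum n q a b x k = bsum q a b (msize n k)"
proof -
  define K where "K = msize n k"
  define c where "c = (\<lambda>s. q powi (- int (k s)))"
  define h where "h = (\<lambda>J. q ^ J * inverse (q ^ (K * J)) * (qpoch q b J * (1 / a) ^ J / qpoch q (q powi (- int K)) J))"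
  define A where "A = (\<Pi>\<^sub>E r\<in>{1..n}. {0..k r})"
  have fin: "finite A"
    unfolding A_def by (intro finite_PiE) auto
  \<comment> \<open>Of r j_r the part (r - 1) j_r belongs to the weight; the rest depends on |j|
    alone.\<close>
  have exps: "q powi ((\<Sum>r = 1..n. int r * int (j r)) - int K * int (msize n j)) =
      q ^ (\<Sum>r = 1..n. (r - 1) * j r) * (q ^ msize n j * inverse (q ^ (K * msize n j)))" for j
  proof -
    have "(\<Sum>r = 1..n. int r * int (j r)) = (\<Sum>r = 1..n. int ((r - 1) * j r) + int (j r))"
      by (intro sum.cong) (auto simp: of_nat_diff algebra_simps)
    hence "(\<Sum>r = 1..n. int r * int (j r)) = int (\<Sum>r = 1..n. (r - 1) * j r) + int (msize n j)"
      by (simp add: sum.distrib msize_def)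
    hence "(\<Sum>r = 1..n. int r * int (j r)) - int K * int (msize n j)
        = int ((\<Sum>r = 1..n. (r - 1) * j r) + msize n j) + - int (K * msize n j)"
      by simp
    thus ?thesis
      by (simp only: power_int_add[OF disjI1[OF q_nz]] power_int_minus power_int_of_nat power_add mult.assoc)
  qed
  have "inner_sum n q a b x k = (\<Sum>j\<in>A. mweight n q x c j * h (msize n j))"
    unfolding inner_sum_def A_def[symmetric] K_def[symmetric] exps h_def mweight_eq[symmetric] c_def
    by (intro sum.cong refl) (simp only: mult_ac)
  also have "\<dots> = (\<Sum>J\<le>K. \<Sum>j\<in>{j\<in>A. msize n j = J}. mweight n q x c j * h (msize n j))"
  proof -
    have "msize n ` A \<subseteq> {..K}"
      unfolding A_def K_def msize_def by (auto intro!: sum_mono simp: PiE_def Pi_def)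
    from sum.group[OF fin finite_atMost this, of "\<lambda>j. mweight n q x c j * h (msize n j)"]
    show ?thesis by (rule sym)
  qed
  also have "\<dots> = (\<Sum>J\<le>K. \<Sum>j\<in>comps n J. mweight n q x c j * h J)"
  proof (rule sum.cong[OF refl], rule sum.mono_neutral_cong_left)
    fix J
    show "{j\<in>A. msize n j = J} \<subseteq> comps n J"
      unfolding comps_def A_def by (auto simp: PiE_def)
    show "\<forall>j\<in>comps n J - {j\<in>A. msize n j = J}. mweight n q x c j * h J = 0"
    proof
      fix j assume "j \<in> comps n J - {j\<in>A. msize n j = J}"
      then obtain r where r: "r \<in> {1..n}" "k r < j r"
        by (auto simp: comps_def A_def PiE_def Pi_def not_le)
      \<comment> \<open>The factor with exponent \<open>k r\<close> is 1 - q^(-k_r) q^(k_r) = 0, and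
        it is present because k_r < j_r.\<close>
      have "qpoch q (c r * (x r / x r)) (j r) = 0"
        unfolding qpoch_eq_0_iff using r x_nz[OF r(1)]
        by (intro exI[of _ "k r"]) (simp add: c_def power_int_minus)
      hence "(\<Prod>s = 1..n. qpoch q (c s * (x r / x s)) (j r) / qpoch q (q * (x r / x s)) (j r)) = 0"
        using r by (intro prod_zero) (auto intro!: bexI[of _ r])
      hence "(\<Prod>r = 1..n. \<Prod>s = 1..n. qpoch q (c s * (x r / x s)) (j r) / qpoch q (q * (x r / x s)) (j r)) = 0"
        using r(1) by (intro prod_zero) blast+
      thus "mweight n q x c j * h J = 0"
        unfolding mweight_def by simp
    qed
  qed auto
  also have "\<dots> = (\<Sum>J\<le>K. qpoch q (\<Prod>s = 1..n. c s) J / qpoch q q J * h J)"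
    by (simp only: sum_distrib_right[symmetric] sum_mweight)
  also have "(\<Prod>s = 1..n. c s) = q powi (- int K)"
    unfolding c_def K_def msize_def power_int_minus power_int_of_nat power_sum
    by (rule prod_inversef[unfolded o_def])
  also have "(\<Sum>J\<le>K. qpoch q (q powi (- int K)) J / qpoch q q J * h J) = bsum q a b K"
    unfolding bsum_def
  proof (intro sum.cong refl)
    fix J assume J: "J \<in> {..K}"
    have "q powi (- int K) * q ^ i \<noteq> 1" if "i < J" for i
    proof
      assume "q powi (- int K) * q ^ i = 1"
      hence "q ^ i * 1 = q ^ K"
        by (simp add: power_int_minus field_simps)
      also have "q ^ K = q ^ i * q ^ (K - i)"
        using that J by (simp flip: power_add)
      finally have "q ^ (K - i) = 1" by simp
      thus False
        using power_neq_1[OF q(2), of "K - i"] that J by simp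
    qed
    hence "qpoch q (q powi (- int K)) J \<noteq> 0"
      by (auto simp: qpoch_eq_0_iff)
    hence "qpoch q (q powi (- int K)) J / qpoch q q J * h J =
        qpoch q b J / qpoch q q J * (q ^ J * inverse (q ^ (K * J)) * (1 / a) ^ J)"
      by (simp add: h_def)
    also have "q ^ J * inverse (q ^ (K * J)) * (1 / a) ^ J = (q / (a * q ^ K)) ^ J"
      by (simp add: power_divide power_mult_distrib power_mult divide_simps)
    finally show "qpoch q (q powi (- int K)) J / qpoch q q J * h J =
        qpoch q b J / qpoch q q J * (q / (a * q ^ K)) ^ J" .
  qed
  finally show ?thesis by (simp add: K_def)
qed

lemma outer_term_eq:
  fixes y :: "nat \<Rightarrow> complex"
  defines "u \<equiv> 1 / (\<Prod>s = 1..n. y s)"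
  shows "outer_term n q a b x y k = mweight n q x y k *
     (ncoeff q a b (msize n k) * u ^ msize n k * qpoch q q (msize n k) / qpoch q (a * q * u) (msize n k))"
proof -
  have "(a / (\<Prod>s = 1..n. y s)) ^ msize n k = a ^ msize n k * u ^ msize n k"
    by (simp add: u_def power_divide)
  moreover have "a * q / (\<Prod>s = 1..n. y s) = a * q * u"
    by (simp add: u_def)
  ultimately show ?thesis
    unfolding outer_term_def mweight_eq[symmetric] ncoeff_def inner_sum_eq by (simp add: power_add mult_ac)
qed

text \<open>Shifting the nodes by powers of q only shrinks them, and each quotient of factorials is
  bounded. Hence the decay of the outer terms is decided by factors that depend on |k|
  alone.\<close>

lemma mweight_bounded:
  obtains C where "\<And>k. norm (mweight n q x c k) \<le> C"
proof -
  have "\<exists>C. \<forall>k. norm (qpoch q (c s * (x r / x s)) k / qpoch q (q * (x r / x s)) k) \<le> C"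
    if rs: "r \<in> {1..n}" "s \<in> {1..n}" for r s
  proof -
    have "q * (x r / x s) * q ^ i \<noteq> 1" for i
    proof
      assume "q * (x r / x s) * q ^ i = 1"
      hence "qpoch q (q * (x r / x s)) (Suc i) = 0"
        by (simp add: qpoch_Suc)
      thus False using qpoch_nz[OF rs] by blast
    qed
    hence "qpoch_inf q (q * (x r / x s)) \<noteq> 0"
      using q by (intro qpoch_inf_nonzero)
    then obtain C where "C > 0" "\<And>k. norm (inverse (qpoch q (q * (x r / x s)) k)) \<le> C"
      using inverse_qpoch_bounded[OF q(2)] by metis
    hence "norm (qpoch q (c s * (x r / x s)) k / qpoch q (q * (x r / x s)) k)
        \<le> exp (norm (c s * (x r / x s)) / (1 - cmod q)) * C" for k
      unfolding divide_inverse[of "qpoch _ _ _"] norm_mult[of "qpoch _ _ _"]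
      by (intro mult_mono norm_qpoch_le q) auto
    thus ?thesis by blast
  qed
  then obtain B where B: "norm (qpoch q (c s * (x r / x s)) k / qpoch q (q * (x r / x s)) k) \<le> B r s"
    if "r \<in> {1..n}" "s \<in> {1..n}" for r s k
    by metis
  define V where "V = (\<Prod>r = 1..n. \<Prod>s\<in>{r<..n}. norm (x r) + norm (x s))"
  have V: "norm (vdm n (\<lambda>r. x r * q ^ k r)) \<le> V" for k
    unfolding vdm_def prod_norm[symmetric] V_def
  proof (intro prod_mono conjI prod_nonneg norm_ge_zero)
    have *: "norm (x r * q ^ k r) \<le> norm (x r)" for r
      using q by (simp add: norm_mult norm_power mult_left_le power_le_one)
    show "norm (x r * q ^ k r - x s * q ^ k s) \<le> norm (x r) + norm (x s)" for r s
      using norm_triangle_ineq4[of "x r * q ^ k r" "x s * q ^ k s"] *[of r] *[of s] by linarith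
  qed
  have "norm (mweight n q x c k) \<le> V / norm (vdm n x) * (\<Prod>r = 1..n. \<Prod>s = 1..n. B r s)" for k
    unfolding mweight_def norm_mult norm_divide[of "vdm _ _"] prod_norm[symmetric]
  proof (intro mult_mono prod_mono conjI prod_nonneg norm_ge_zero divide_right_mono V)
    show "0 \<le> V / norm (vdm n x)"
      unfolding V_def by (intro divide_nonneg_nonneg prod_nonneg) auto
  qed (use B in auto)
  thus ?thesis using that by blast
qed

text \<open>Apart from the weight, the outer term depends on |k| only. The sum of the weights is
  (Y)_K/(q)_K; its denominator cancels, and (Y)_K u^K is the Newton product.\<close>

lemma sum_outer_term:
  fixes y :: "nat \<Rightarrow> complex"
  defines "u \<equiv> 1 / (\<Prod>s = 1..n. y s)"
  assumes y: "(\<Prod>s = 1..n. y s) \<noteq> 0"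
  shows "(\<Sum>k\<in>comps n K. outer_term n q a b x y k) = ncoeff q a b K * nprod q u K / qpoch q (a * q * u) K"
proof -
  have "(\<Sum>k\<in>comps n K. outer_term n q a b x y k) =
      (\<Sum>k\<in>comps n K. mweight n q x y k * (ncoeff q a b K * u ^ K * qpoch q q K / qpoch q (a * q * u) K))"
    unfolding outer_term_eq u_def by (intro sum.cong) (auto simp: comps_def)
  also have "\<dots> = qpoch q (\<Prod>s = 1..n. y s) K / qpoch q q K * (ncoeff q a b K * u ^ K * qpoch q q K / qpoch q (a * q * u) K)"
    by (simp only: sum_distrib_right[symmetric] sum_mweight)
  also have "nprod q u K = qpoch q (\<Prod>s = 1..n. y s) K * u ^ K"
    using y by (intro nprod_eq_qpoch) (simp add: u_def)
  hence "qpoch q (\<Prod>s = 1..n. y s) K / qpoch q q K * (ncoeff q a b K * u ^ K * qpoch q q K / qpoch q (a * q * u) K)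
      = ncoeff q a b K * nprod q u K / qpoch q (a * q * u) K"
    using qpoch_q_nonzero[OF q(2), of K] by simp
  finally show ?thesis .
qed

end

section \<open>Multi-index sums grouped by size\<close>

lemma bij_betw_comps: "bij_betw snd (SIGMA N:UNIV. comps n N) ({1..n} \<rightarrow>\<^sub>E UNIV)"
  by (rule bij_betwI[of _ _ _ "\<lambda>k. (msize n k, k)"]) (auto simp: comps_def)

lemma has_sum_comps:
  fixes f :: "(nat \<Rightarrow> nat) \<Rightarrow> complex"
  assumes "(f has_sum S) ({1..n} \<rightarrow>\<^sub>E UNIV)"
  shows "((\<lambda>N. \<Sum>k\<in>comps n N. f k) has_sum S) UNIV"
proof (rule has_sum_SigmaD)
  show "((\<lambda>p. f (snd p)) has_sum S) (SIGMA N:UNIV. comps n N)"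
    using assms has_sum_reindex_bij_betw[OF bij_betw_comps] by blast
  show "((\<lambda>k. f (snd (N, k))) has_sum (\<Sum>k\<in>comps n N. f k)) (comps n N)" for N
    by (simp add: has_sum_finite)
qed

text \<open>Summability of the whole family justifies the grouping; the series over N then only
  identifies the value.\<close>

lemma has_sum_of_comps_sums:
  fixes f :: "(nat \<Rightarrow> nat) \<Rightarrow> complex"
  assumes f: "f summable_on ({1..n} \<rightarrow>\<^sub>E UNIV)" and "(\<lambda>N. \<Sum>k\<in>comps n N. f k) sums S"
  shows "(f has_sum S) ({1..n} \<rightarrow>\<^sub>E UNIV)"
proof -
  obtain S' where S': "(f has_sum S') ({1..n} \<rightarrow>\<^sub>E UNIV)"
    using f by (auto simp: summable_on_def)
  hence "(\<lambda>N. \<Sum>k\<in>comps n N. f k) sums S'"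
    by (intro has_sum_imp_sums has_sum_comps)
  with assms(2) have "S' = S"
    by (rule sums_unique2[symmetric])
  thus ?thesis using S' by simp
qed

lemma summable_polynomial_geometric:
  fixes \<rho> :: real
  assumes "0 \<le> \<rho>" "\<rho> < 1"
  shows "summable (\<lambda>N. real (Suc N) ^ n * \<rho> ^ N)"
proof -
  have "(\<lambda>N. 1 + inverse (real (Suc N))) \<longlonglongrightarrow> 1 + 0"
    by (intro tendsto_intros LIMSEQ_inverse_real_of_nat)
  hence "(\<lambda>N. (1 + inverse (real (Suc N))) ^ n * \<rho>) \<longlonglongrightarrow> (1 + 0) ^ n * \<rho>"
    by (rule tendsto_mult[OF tendsto_power tendsto_const])
  \<comment> \<open>The ratios tend to \<open>\<rho>\<close>, and (1 + \<open>\<rho>\<close>)/2 lies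
    strictly between that limit and 1.\<close>
  moreover have "(1 + 0) ^ n * \<rho> < (1 + \<rho>) / 2"
    using assms by simp
  ultimately have "\<forall>\<^sub>F N in sequentially. (1 + inverse (real (Suc N))) ^ n * \<rho> < (1 + \<rho>) / 2"
    by (rule order_tendstoD)
  then obtain N0 where N0: "\<And>N. N \<ge> N0 \<Longrightarrow> (1 + inverse (real (Suc N))) ^ n * \<rho> < (1 + \<rho>) / 2"
    unfolding eventually_sequentially by blast
  show ?thesis
  proof (rule summable_ratio_test[of "(1 + \<rho>) / 2" N0])
    fix N assume N: "N \<ge> N0"
    have "real (Suc (Suc N)) = (1 + inverse (real (Suc N))) * real (Suc N)"
      by (simp add: field_simps)
    hence "real (Suc (Suc N)) ^ n * \<rho> ^ Suc N =
        ((1 + inverse (real (Suc N))) ^ n * \<rho>) * (real (Suc N) ^ n * \<rho> ^ N)"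
      by (simp only: power_mult_distrib power_Suc mult_ac)
    also have "\<dots> \<le> (1 + \<rho>) / 2 * (real (Suc N) ^ n * \<rho> ^ N)"
      using N0[OF N] assms by (intro mult_right_mono) auto
    finally show "norm (real (Suc (Suc N)) ^ n * \<rho> ^ Suc N) \<le> (1 + \<rho>) / 2 * norm (real (Suc N) ^ n * \<rho> ^ N)"
      using assms by simp
  qed (use assms in auto)
qed

text \<open>At most (N + 1)^n multi-indices have size N, since every entry is at most N; polynomial
  growth does not spoil the geometric decay.\<close>

lemma summable_on_multiindex:
  fixes f :: "(nat \<Rightarrow> nat) \<Rightarrow> complex"
  assumes \<rho>: "0 \<le> \<rho>" "\<rho> < 1" and f: "\<And>k. norm (f k) \<le> C * \<rho> ^ msize n k"
  shows "f summable_on ({1..n} \<rightarrow>\<^sub>E UNIV)"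
proof -
  define F where "F = (\<lambda>N. \<Sum>k\<in>comps n N. norm (f k))"
  have "norm (f (\<lambda>_. 0)) \<le> C"
    using f[of "\<lambda>_. 0"] by (simp add: msize_def)
  hence C: "C \<ge> 0"
    using norm_ge_zero order.trans by blast
  have "F N \<le> C * (real (Suc N) ^ n * \<rho> ^ N)" for N
  proof -
    have "F N \<le> (\<Sum>k\<in>comps n N. C * \<rho> ^ N)"
      unfolding F_def
    proof (rule sum_mono)
      fix k assume "k \<in> comps n N"
      thus "norm (f k) \<le> C * \<rho> ^ N"
        using f[of k] by (simp add: comps_def)
    qed
    also have "\<dots> = real (card (comps n N)) * (C * \<rho> ^ N)"
      by simp
    also have "card (comps n N) \<le> card ({1..n} \<rightarrow>\<^sub>E {..N})"
      by (intro card_mono comps_subset finite_PiE) auto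
    hence "card (comps n N) \<le> Suc N ^ n"
      by (simp add: card_PiE)
    hence "real (card (comps n N)) \<le> real (Suc N) ^ n"
      by (simp only: of_nat_power[symmetric] of_nat_le_iff)
    hence "real (card (comps n N)) * (C * \<rho> ^ N) \<le> real (Suc N) ^ n * (C * \<rho> ^ N)"
      using C \<rho> by (intro mult_right_mono) auto
    finally show ?thesis by (simp add: mult_ac)
  qed
  moreover have "F N \<ge> 0" for N
    unfolding F_def by (intro sum_nonneg) auto
  ultimately have "norm (norm (F N)) \<le> C * (real (Suc N) ^ n * \<rho> ^ N)" for N
    by (metis abs_of_nonneg real_norm_def)
  hence "summable (\<lambda>N. norm (F N))"
    by (rule summable_comparison_test'[OF summable_mult[OF summable_polynomial_geometric[OF \<rho>]]])
  hence "F summable_on UNIV"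
    by (rule norm_summable_imp_summable_on)
  hence "(\<lambda>p. norm (f (snd p))) summable_on (SIGMA N:UNIV. comps n N)"
    by (rule summable_on_SigmaI[rotated]) (auto simp: F_def has_sum_finite)
  hence "(\<lambda>k. norm (f k)) summable_on ({1..n} \<rightarrow>\<^sub>E UNIV)"
    using summable_on_reindex_bij_betw[OF bij_betw_comps, of "\<lambda>k. norm (f k)" n] by blast
  thus ?thesis
    using summable_on_iff_abs_summable_on_complex by blast
qed

theorem theorem9p1:
  fixes q a b :: complex and x y :: "nat \<Rightarrow> complex" and n :: nat
  assumes q: "0 < cmod q" "cmod q < 1"
    and n: "n \<ge> 1"
    and denominators: "denominators_nonzero n q a b x y"
    and convergence: "cmod (q / (\<Prod>s = 1..n. y s)) < 1
           \<or> outer_term n q a b x y summable_on ({1..n} \<rightarrow>\<^sub>E UNIV)"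
  shows "(outer_term n q a b x y has_sum
            (qpoch_inf q q * qpoch_inf q (a * q) * qpoch_inf q (b * q / (\<Prod>s = 1..n. y s)))
            / (qpoch_inf q (a * q / (\<Prod>s = 1..n. y s)) * qpoch_inf q (b * q)
                * qpoch_inf q (q / (\<Prod>s = 1..n. y s))))
          ({1..n} \<rightarrow>\<^sub>E UNIV)"
proof -
  define Y where "Y = (\<Prod>s = 1..n. y s)"
  define u where "u = 1 / Y"
  have a: "a \<noteq> 0" "a \<noteq> 1" and Y: "Y \<noteq> 0"
    and x_nz: "\<And>s. s \<in> {1..n} \<Longrightarrow> x s \<noteq> 0"
    and x_ne: "\<And>r s. r \<in> {1..n} \<Longrightarrow> s \<in> {r<..n} \<Longrightarrow> 1 - x r / x s \<noteq> 0"
    and x_q: "\<And>r s m. r \<in> {1..n} \<Longrightarrow> s \<in> {1..n} \<Longrightarrow> qpoch q (q * (x r / x s)) m \<noteq> 0"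
    and aqu: "qpoch_inf q (a * q * u) \<noteq> 0" and b: "qpoch_inf q (b * q) \<noteq> 0" and qu: "qpoch_inf q (q * u) \<noteq> 0"
    using denominators unfolding denominators_nonzero_def Y_def[symmetric] u_def by auto
  have x_neq: "x r \<noteq> x s" if "r \<in> {1..n}" "s \<in> {1..n}" "r \<noteq> s" for r s
    using that x_ne[of r s] x_ne[of s r] x_nz[of r] x_nz[of s] by (cases "r < s") auto
  interpret generic_nodes n q x
    by unfold_locales (use q x_nz x_neq x_q in auto)
  have u: "u \<noteq> 0" using Y by (simp add: u_def)
  have Yu: "Y * u = 1" using Y by (simp add: u_def)
  define F where "F = (\<lambda>K. ncoeff q a b K * nprod q u K / qpoch q (a * q * u) K)"
  have F: "(\<Sum>k\<in>comps n K. outer_term n q a b x y k) = F K" for K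
    using sum_outer_term[of y a b K] Y unfolding F_def u_def Y_def by simp
  obtain C where C: "C > 0" "\<And>K. norm (ncoeff q a b K) \<le> C * cmod q ^ K"
    using ncoeff_bound[OF q a(1) b] by metis
  obtain C' where C': "C' > 0" "\<And>K. norm (inverse (qpoch q (a * q * u) K)) \<le> C'"
    using inverse_qpoch_bounded[OF q(2) aqu] by metis
  \<comment> \<open>The second conjunct is what \<open>one_variable_sums\<close> requires. For |qu|
    < 1 both follow from \<open>ncoeff_bound\<close> and \<open>mweight_bounded\<close>, the terms
    being O(|qu|^|k|).\<close>
  have "outer_term n q a b x y summable_on ({1..n} \<rightarrow>\<^sub>E UNIV) \<and> summable (\<lambda>K. norm (ncoeff q a b K) * norm u ^ K)"
  proof (cases "cmod (q * u) < 1")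
    case True
    define \<rho> where "\<rho> = cmod (q * u)"
    have bound: "norm (ncoeff q a b K) * norm u ^ K \<le> C * \<rho> ^ K" for K
    proof -
      have "norm (ncoeff q a b K) * norm u ^ K \<le> (C * cmod q ^ K) * norm u ^ K"
        by (intro mult_right_mono C) auto
      thus ?thesis by (simp add: \<rho>_def norm_mult power_mult_distrib mult_ac)
    qed
    obtain B where B: "\<And>k. norm (mweight n q x y k) \<le> B"
      using mweight_bounded by metis
    define E where "E = exp (cmod q / (1 - cmod q))"
    have "norm (outer_term n q a b x y k) \<le> (B * C * E * C') * \<rho> ^ msize n k" for k
    proof -
      define K where "K = msize n k"
      have "norm (outer_term n q a b x y k) = norm (mweight n q x y k) *
          ((norm (ncoeff q a b K) * norm u ^ K) * norm (qpoch q q K) * norm (inverse (qpoch q (a * q * u) K)))"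
        unfolding outer_term_eq Y_def[symmetric] u_def[symmetric] K_def[symmetric]
        by (simp add: norm_mult norm_divide norm_power norm_inverse divide_inverse)
      also have "\<dots> \<le> B * ((C * \<rho> ^ K) * E * C')"
      proof -
        have "C * \<rho> ^ K \<ge> 0"
          using C(1) by (simp add: \<rho>_def)
        hence "(norm (ncoeff q a b K) * norm u ^ K) * norm (qpoch q q K) \<le> (C * \<rho> ^ K) * E"
          unfolding E_def by (intro mult_mono[OF bound] norm_qpoch_le q) auto
        hence "(norm (ncoeff q a b K) * norm u ^ K) * norm (qpoch q q K) * norm (inverse (qpoch q (a * q * u) K))
            \<le> (C * \<rho> ^ K) * E * C'"
          using \<open>C * \<rho> ^ K \<ge> 0\<close> by (intro mult_mono[OF _ C'(2)]) (auto simp: E_def)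
        thus ?thesis
          by (intro mult_mono[OF B]) (auto intro: order.trans[OF norm_ge_zero B])
      qed
      finally show ?thesis by (simp add: K_def mult_ac)
    qed
    hence "outer_term n q a b x y summable_on ({1..n} \<rightarrow>\<^sub>E UNIV)"
      using True by (intro summable_on_multiindex[of \<rho>]) (auto simp: \<rho>_def)
    moreover have "summable (\<lambda>K. C * \<rho> ^ K)"
      using True by (intro summable_mult summable_geometric) (simp add: \<rho>_def)
    hence "summable (\<lambda>K. norm (ncoeff q a b K) * norm u ^ K)"
    proof (rule summable_comparison_test')
      show "norm (norm (ncoeff q a b K) * norm u ^ K) \<le> C * \<rho> ^ K" if "0 \<le> K" for K
        using bound[of K] by (simp only: real_norm_def abs_mult power_abs abs_norm_cancel)
    qed
    ultimately show ?thesis by blast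
  next
    \<comment> \<open>Here \<open>|Y| \<le> |q|\<close>, so \<open>(Y)\<^sub>K\<close> stays away from \<open>0\<close> and the assumed summability passes to
       the Newton coefficients.\<close>
    case False
    hence summ: "outer_term n q a b x y summable_on ({1..n} \<rightarrow>\<^sub>E UNIV)"
      using convergence by (simp add: u_def Y_def)
    hence "F summable_on UNIV"
      using has_sum_comps[where n = n and f = "outer_term n q a b x y"] unfolding summable_on_def F by blast
    \<comment> \<open>For complex families summability is absolute, and absolute summability
      survives multiplication by the bounded factors (aqu)_K/(Y)_K.\<close>
    hence "(\<lambda>K. norm (F K)) summable_on UNIV"
      using summable_on_iff_abs_summable_on_complex by blast
    hence F_summ: "summable (\<lambda>K. norm (F K))"
      by (rule summable_on_imp_summable)
    have Y_le: "cmod Y \<le> cmod q"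
      using False Y by (simp add: u_def norm_divide field_simps)
    have "Y * q ^ i \<noteq> 1" for i
    proof
      assume *: "Y * q ^ i = 1"
      have "cmod (Y * q ^ i) \<le> cmod q * 1"
        unfolding norm_mult norm_power using q Y_le by (intro mult_mono power_le_one) auto
      thus False using * q by simp
    qed
    hence "qpoch_inf q Y \<noteq> 0"
      using q by (intro qpoch_inf_nonzero)
    then obtain B where B: "B > 0" "\<And>k. norm (inverse (qpoch q Y k)) \<le> B"
      using inverse_qpoch_bounded[OF q(2)] by metis
    define E where "E = exp (cmod (a * q * u) / (1 - cmod q))"
    have "norm (ncoeff q a b K) * norm u ^ K \<le> E * B * norm (F K)" for K
    proof -
      have nz: "qpoch q Y K \<noteq> 0" "qpoch q (a * q * u) K \<noteq> 0"
        using qpoch_nonzero[OF q(2)] aqu \<open>qpoch_inf q Y \<noteq> 0\<close> by blast+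
      have "ncoeff q a b K * u ^ K = F K * qpoch q (a * q * u) K * inverse (qpoch q Y K)"
        using nz unfolding F_def nprod_eq_qpoch[OF Yu] by (simp add: field_simps)
      hence "norm (ncoeff q a b K) * norm u ^ K = norm (F K) * norm (qpoch q (a * q * u) K) * norm (inverse (qpoch q Y K))"
        by (metis norm_mult norm_power)
      also have "\<dots> \<le> norm (F K) * E * B"
        unfolding E_def by (intro mult_mono B norm_qpoch_le q) auto
      finally show ?thesis by (simp add: mult_ac)
    qed
    hence "norm (norm (ncoeff q a b K) * norm u ^ K) \<le> E * B * norm (F K)" for K
      by (simp only: real_norm_def abs_mult power_abs abs_norm_cancel)
    hence "summable (\<lambda>K. norm (ncoeff q a b K) * norm u ^ K)"
      by (rule summable_comparison_test'[OF summable_mult[OF F_summ]])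
    with summ show ?thesis by blast
  qed
  hence "(outer_term n q a b x y has_sum
      (qpoch_inf q q * qpoch_inf q (a * q) * qpoch_inf q (b * q * u)
       / (qpoch_inf q (a * q * u) * qpoch_inf q (b * q) * qpoch_inf q (q * u)))) ({1..n} \<rightarrow>\<^sub>E UNIV)"
    using one_variable_sums[OF q a b u aqu qu] by (intro has_sum_of_comps_sums) (simp_all add: F F_def)
  thus ?thesis
    by (simp add: u_def Y_def)
qed

end
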